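(* Let $C\subseteq\mathbb{P}^3$ be a general codimension $2$ complete intersection defined by two forms of degrees $a$ and $b$ respectively, with $a\le b$. Set $t:=(a-1)(b-1)+1$ and $m:=(a-1)(b-1)$. If $a>2$, then $C$ admits an unexpected hypersurface of degree $t$ for multiplicity $m$.
   Context: $K$ is an algebraically closed field and $R=K[x_0,x_1,x_2,x_3]$. For a closed subscheme $C\subseteq\mathbb{P}^3$, $I_C\subseteq R$ is its saturated homogeneous ideal and $[\,\cdot\,]_t$ denotes the degree $t$ component. Let $P\in\mathbb{P}^3$ be a general point with ideal $I_P$. Set $\operatorname{adim}(C,t,m)=\dim[I_C\cap I_P^m]_t$, $\operatorname{vdim}(C,t,m)=\dim[I_C]_t-\binom{m+2}{3}$, $\operatorname{edim}(C,t,m)=\max\{0,\operatorname{vdim}(C,t,m)\}$. $C$ admits an unexpected hypersurface of degree $t$ for multiplicity $m$ if $\operatorname{adim}(C,t,m)>\operatorname{edim}(C,t,m)$. "General" complete intersection means that the pair of defining forms lies in a suitable nonempty Zariski open subset of the space of pairs of forms of degrees $a,b$. *)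

theory Defs
  imports
    "HOL-Library.Poly_Mapping"
    "HOL-Library.Numeral_Type"
    "HOL-Computational_Algebra.Polynomial"
begin

text \<open>
  Polynomials in variables indexed by \<open>'i\<close> with coefficients in \<open>'k\<close>: finitely supported maps
  from exponent vectors to coefficients, with the convolution product.
\<close>

type_synonym ('i, 'k) mpol = "('i \<Rightarrow>\<^sub>0 nat) \<Rightarrow>\<^sub>0 'k"

text \<open>The ring \<open>R = K[x\<^sub>0, x\<^sub>1, x\<^sub>2, x\<^sub>3]\<close>; the type \<open>4\<close> has exactly four elements.\<close>

type_synonym 'k R4 = "(4, 'k) mpol"

definition mvar :: "'i \<Rightarrow> ('i, 'k::zero_neq_one) mpol" where
  "mvar i = Poly_Mapping.single (Poly_Mapping.single i 1) 1"

definition mdeg :: "('i \<Rightarrow>\<^sub>0 nat) \<Rightarrow> nat" where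
  "mdeg e = (\<Sum>i\<in>Poly_Mapping.keys e. Poly_Mapping.lookup e i)"

definition mev :: "('i \<Rightarrow> 'k) \<Rightarrow> ('i, 'k::comm_ring_1) mpol \<Rightarrow> 'k" where
  "mev x p = (\<Sum>e\<in>Poly_Mapping.keys p. Poly_Mapping.lookup p e *
     (\<Prod>i\<in>Poly_Mapping.keys e. x i ^ Poly_Mapping.lookup e i))"

text \<open>The degree \<open>d\<close> component of the polynomial ring, including \<open>0\<close>.\<close>

definition forms :: "nat \<Rightarrow> ('i, 'k::zero) mpol set" where
  "forms d = {p. \<forall>e\<in>Poly_Mapping.keys p. mdeg e = d}"

definition kscale :: "'k \<Rightarrow> ('i, 'k::comm_ring_1) mpol \<Rightarrow> ('i, 'k) mpol" where
  "kscale c p = Poly_Mapping.single 0 c * p"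

lemma vector_space_kscale:
  "vector_space (kscale :: 'k \<Rightarrow> ('i, 'k::field) mpol \<Rightarrow> ('i, 'k) mpol)"
  by unfold_locales
    (simp_all add: kscale_def distrib_left distrib_right single_add mult_single
       flip: mult.assoc)

definition kdim :: "('i, 'k::field) mpol set \<Rightarrow> nat" where
  "kdim V = vector_space.dim kscale V"


section \<open>Ideals\<close>

definition gen_ideal :: "'r::comm_ring_1 set \<Rightarrow> 'r set" where
  "gen_ideal S = module.span (*) S"

lemma module_times: "module ((*) :: 'r::comm_ring_1 \<Rightarrow> 'r \<Rightarrow> 'r)"
  by unfold_locales (simp_all add: algebra_simps)

primrec idl_power :: "'r::comm_ring_1 set \<Rightarrow> nat \<Rightarrow> 'r set" where
  "idl_power I 0 = UNIV"
| "idl_power I (Suc n) = gen_ideal {f * g | f g. f \<in> I \<and> g \<in> idl_power I n}"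

text \<open>The saturation \<open>I : \<mm>\<^sup>\<infinity>\<close> with respect to the irrelevant ideal \<open>\<mm>\<close> generated by the variables.\<close>

definition sat_idl :: "('i, 'k::comm_ring_1) mpol set \<Rightarrow> ('i, 'k) mpol set" where
  "sat_idl I = {f. \<exists>n. \<forall>g\<in>idl_power (gen_ideal (range mvar)) n. g * f \<in> I}"

definition regular_seq :: "'r::comm_ring_1 list \<Rightarrow> bool" where
  "regular_seq fs \<longleftrightarrow>
     (\<forall>i<length fs. \<forall>h. fs ! i * h \<in> gen_ideal (set (take i fs)) \<longrightarrow> h \<in> gen_ideal (set (take i fs)))
     \<and> gen_ideal (set fs) \<noteq> UNIV"

text \<open>
  Two forms define a codimension 2 complete intersection iff they form a regular sequence.
  Its saturated ideal is \<open>sat_idl (gen_ideal {F, G})\<close>.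
\<close>

definition defines_ci2 :: "'k::comm_ring_1 R4 \<Rightarrow> 'k R4 \<Rightarrow> bool" where
  "defines_ci2 F G \<longleftrightarrow> regular_seq [F, G]"

definition scheme_idl2 :: "'k::comm_ring_1 R4 \<Rightarrow> 'k R4 \<Rightarrow> 'k R4 set" where
  "scheme_idl2 F G = sat_idl (gen_ideal {F, G})"


section \<open>General points and general pairs of forms\<close>

text \<open>
  A point of \<open>\<bbbP>\<^sup>3\<close> is represented by homogeneous coordinates, a nonzero function on the type \<open>4\<close>.
  A Zariski open set of \<open>\<bbbP>\<^sup>3\<close> is represented by its cone without the origin; since the equations
  in \<open>S\<close> are homogeneous, this set is invariant under rescaling.
\<close>

definition proj_open :: "(4 \<Rightarrow> 'k::field) set \<Rightarrow> bool" where
  "proj_open V \<longleftrightarrow> (\<exists>S. S \<subseteq> (\<Union>d. forms d) \<and> V = {P. P \<noteq> (\<lambda>_. 0) \<and> (\<exists>p\<in>S. mev P p \<noteq> 0)})"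

definition for_general_point :: "((4 \<Rightarrow> 'k::field) \<Rightarrow> bool) \<Rightarrow> bool" where
  "for_general_point Q \<longleftrightarrow> (\<exists>V. proj_open V \<and> V \<noteq> {} \<and> (\<forall>P\<in>V. Q P))"

text \<open>
  Zariski open subsets of the affine space \<open>[R]\<^sub>a \<times> [R]\<^sub>b\<close>: the equations are polynomials in the
  coefficients of \<open>F\<close> (variables \<open>Inl e\<close>) and of \<open>G\<close> (variables \<open>Inr e\<close>), indexed by exponent
  vectors \<open>e\<close>.  Variables with \<open>mdeg e\<close> different from \<open>a\<close>, resp. \<open>b\<close>, evaluate to \<open>0\<close>.
\<close>

definition forms_pair_open :: "nat \<Rightarrow> nat \<Rightarrow> ('k::field R4 \<times> 'k R4) set \<Rightarrow> bool" where
  "forms_pair_open a b U \<longleftrightarrow>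
     (\<exists>S. U = {(F, G). F \<in> forms a \<and> G \<in> forms b \<and>
        (\<exists>p\<in>S. mev (case_sum (Poly_Mapping.lookup F) (Poly_Mapping.lookup G)) p \<noteq> 0)})"


section \<open>Unexpected hypersurfaces\<close>

text \<open>Below, \<open>I\<close> is the saturated homogeneous ideal \<open>I\<^sub>C\<close> of a closed subscheme \<open>C\<close> of \<open>\<bbbP>\<^sup>3\<close>.\<close>

definition point_idl :: "(4 \<Rightarrow> 'k::field) \<Rightarrow> 'k R4 set" where
  "point_idl P = gen_ideal {f. (\<exists>d. f \<in> forms d) \<and> mev P f = 0}"

text \<open>
  For a general point, adim is the common value of \<open>adim I t m P\<close> at general points \<open>P\<close>; statements
  about it are therefore required to hold for all \<open>P\<close> in a nonempty Zariski open set.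
\<close>

definition adim :: "'k::field R4 set \<Rightarrow> nat \<Rightarrow> nat \<Rightarrow> (4 \<Rightarrow> 'k) \<Rightarrow> nat" where
  "adim I t m P = kdim (I \<inter> idl_power (point_idl P) m \<inter> forms t)"

definition vdim :: "'k::field R4 set \<Rightarrow> nat \<Rightarrow> nat \<Rightarrow> int" where
  "vdim I t m = int (kdim (I \<inter> forms t)) - int ((m + 2) choose 3)"

definition edim :: "'k::field R4 set \<Rightarrow> nat \<Rightarrow> nat \<Rightarrow> int" where
  "edim I t m = max 0 (vdim I t m)"

definition admits_unexpected :: "'k::field R4 set \<Rightarrow> nat \<Rightarrow> nat \<Rightarrow> bool" where
  "admits_unexpected I t m \<longleftrightarrow> for_general_point (\<lambda>P. int (adim I t m P) > edim I t m)"

end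

theory Submission
  imports Defs "Jordan_Normal_Form.Char_Poly"
begin

text \<open>
  The first subresultant of \<open>F\<close> and \<open>G\<close>, in the direction of \<open>P\<close>, defines the unexpected surface.

  On the lines through \<open>P\<close> the forms \<open>F\<close> and \<open>G\<close> become polynomials in one variable of degrees \<open>a\<close>
  and \<open>b\<close>. Their coefficients are forms in linear forms that vanish at \<open>P\<close>, the coefficient of
  \<open>X\<^sup>j\<close> having degree \<open>a - j\<close> or \<open>b - j\<close>. Their first subresultant \<open>s\<^sub>0 + s\<^sub>1 X\<close> is a combination of
  them, and \<open>s\<^sub>1\<close> and \<open>s\<^sub>0\<close> are homogeneous of degrees \<open>m = (a - 1) (b - 1)\<close> and \<open>m + 1\<close> in the linear
  forms (\<open>subres_bezout\<close>, \<open>graded.subres_coeff_mem\<close>). Evaluated at a coordinate that does not vanish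
  at \<open>P\<close>, it is a form of degree \<open>m + 1\<close> in the ideal of \<open>C\<close> with multiplicity at least \<open>m\<close> at \<open>P\<close>
  (\<open>subresultant_surface\<close>). It is nonzero for general \<open>F\<close>, \<open>G\<close> and \<open>P\<close>, because \<open>s\<^sub>1\<close> is nonzero for the pair
  \<open>x\<^sub>2\<^sup>a + x\<^sub>0 x\<^sub>1\<^sup>a\<^sup>-\<^sup>1\<close>, \<open>x\<^sub>3\<^sup>b + x\<^sub>0\<^sup>b\<close> at \<open>P = (1 : 0 : 0 : 0)\<close>. The same pair shows that the open
  set of pairs in \<open>general_pairs\<close> is nonempty.

  The expected dimension is zero for \<open>a, b \<ge> 3\<close> (\<open>edim_eq_0\<close>). Indeed the saturated ideal of \<open>C\<close> is
  \<open>(F, G)\<close>: the resultant of \<open>F\<close> and \<open>G\<close> with respect to \<open>x\<^sub>3\<close> does not vanish modulo \<open>x\<^sub>0\<close>, so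
  \<open>F, G, x\<^sub>0\<close> is a regular sequence (\<open>regular_pair\<close>, \<open>regular_triple\<close>). In degree \<open>t\<close> this ideal has
  dimension at most \<open>dim [R]\<^sub>t\<^sub>-\<^sub>a + dim [R]\<^sub>t\<^sub>-\<^sub>b - dim [R]\<^sub>t\<^sub>-\<^sub>a\<^sub>-\<^sub>b\<close> (\<open>kdim_pair_ideal_le\<close>), which
  for \<open>t = m + 1\<close> does not exceed the number of conditions imposed by the point
  (\<open>binomial_inequality\<close>).
\<close>

section \<open>Substitution into polynomials\<close>

text \<open>The value of the monomial with exponent vector \<open>e\<close> at \<open>v\<close>.\<close>

definition monom_val :: "('i \<Rightarrow> 's::comm_ring_1) \<Rightarrow> ('i \<Rightarrow>\<^sub>0 nat) \<Rightarrow> 's" where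
  "monom_val v e = (\<Prod>i\<in>Poly_Mapping.keys e. v i ^ Poly_Mapping.lookup e i)"

text \<open>
  Substitution of \<open>v\<close> for the variables, with coefficients mapped by \<open>\<phi>\<close>. Evaluation at a point is
  the case where \<open>\<phi>\<close> is the identity.
\<close>

definition msubst :: "('k::comm_ring_1 \<Rightarrow> 's::comm_ring_1) \<Rightarrow> ('i \<Rightarrow> 's) \<Rightarrow> ('i, 'k) mpol \<Rightarrow> 's" where
  "msubst \<phi> v p = (\<Sum>e\<in>Poly_Mapping.keys p. \<phi> (Poly_Mapping.lookup p e) * monom_val v e)"

lemma mev_eq_msubst: "mev x = msubst (\<lambda>c. c) x"
  by (auto simp: mev_def msubst_def monom_val_def)

lemma monom_val_superset:
  assumes "finite A" and "Poly_Mapping.keys e \<subseteq> A"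
  shows "monom_val v e = (\<Prod>i\<in>A. v i ^ Poly_Mapping.lookup e i)"
  unfolding monom_val_def
  by (rule prod.mono_neutral_left[OF assms]) (auto simp: in_keys_iff)

lemma monom_val_zero [simp]: "monom_val v 0 = 1"
  by (simp add: monom_val_def)

lemma monom_val_add: "monom_val v (d + e) = monom_val v d * monom_val v e"
proof -
  let ?A = "Poly_Mapping.keys d \<union> Poly_Mapping.keys e"
  have "Poly_Mapping.keys (d + e) \<subseteq> ?A"
    by (rule keys_add)
  then show ?thesis
    by (simp add: monom_val_superset[of ?A] lookup_add power_add prod.distrib)
qed

lemma monom_val_single [simp]: "monom_val v (Poly_Mapping.single i n) = v i ^ n"
  by (cases "n = 0") (auto simp: monom_val_def)

lemma monom_val_hom:
  assumes "comm_ring_hom \<psi>"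
  shows "\<psi> (monom_val v e) = monom_val (\<lambda>i. \<psi> (v i)) e"
proof -
  interpret comm_ring_hom \<psi> by fact
  show ?thesis by (simp add: monom_val_def hom_distribs)
qed

lemma mpol_sum_single:
  fixes p :: "'a \<Rightarrow>\<^sub>0 'b::comm_monoid_add"
  shows "p = (\<Sum>e\<in>Poly_Mapping.keys p. Poly_Mapping.single e (Poly_Mapping.lookup p e))"
  by (rule poly_mapping_eqI)
    (auto simp: lookup_sum lookup_single when_def in_keys_iff sum.delta')

lemma mpol_induct [case_names zero single add]:
  fixes p :: "'a \<Rightarrow>\<^sub>0 'b::comm_monoid_add"
  assumes z: "P 0" and s: "\<And>e c. e \<in> Poly_Mapping.keys p \<Longrightarrow> P (Poly_Mapping.single e c)"
    and a: "\<And>p q. P p \<Longrightarrow> P q \<Longrightarrow> P (p + q)"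
  shows "P p"
proof -
  have "P (\<Sum>e\<in>A. Poly_Mapping.single e (Poly_Mapping.lookup p e))"
    if "finite A" "A \<subseteq> Poly_Mapping.keys p" for A
    using that by (induction rule: finite_induct) (auto intro: z s a)
  from this[of "Poly_Mapping.keys p"] show ?thesis
    using mpol_sum_single[of p] by simp
qed

lemma msubst_superset:
  assumes "comm_ring_hom \<phi>" and "finite A" and "Poly_Mapping.keys p \<subseteq> A"
  shows "msubst \<phi> v p = (\<Sum>e\<in>A. \<phi> (Poly_Mapping.lookup p e) * monom_val v e)"
proof -
  interpret comm_ring_hom \<phi> by fact
  show ?thesis
    unfolding msubst_def
    by (rule sum.mono_neutral_left[OF assms(2,3)]) (auto simp: in_keys_iff)
qed

lemma msubst_single:
  assumes "comm_ring_hom \<phi>"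
  shows "msubst \<phi> v (Poly_Mapping.single e c) = \<phi> c * monom_val v e"
proof -
  interpret comm_ring_hom \<phi> by fact
  show ?thesis by (cases "c = 0") (auto simp: msubst_def)
qed

lemma msubst_add:
  assumes "comm_ring_hom \<phi>"
  shows "msubst \<phi> v (p + q) = msubst \<phi> v p + msubst \<phi> v q"
proof -
  interpret comm_ring_hom \<phi> by fact
  let ?A = "Poly_Mapping.keys p \<union> Poly_Mapping.keys q"
  have "Poly_Mapping.keys (p + q) \<subseteq> ?A"
    by (rule keys_add)
  then show ?thesis
    by (simp add: msubst_superset[OF assms, of ?A] lookup_add hom_distribs distrib_right sum.distrib)
qed

lemma msubst_hom:
  assumes "comm_ring_hom \<phi>"
  shows "comm_ring_hom (msubst \<phi> v)"
proof -
  interpret comm_ring_hom \<phi> by fact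
  note add = msubst_add[OF assms]
  have z: "msubst \<phi> v 0 = 0"
    by (simp add: msubst_def)
  have mult1: "msubst \<phi> v (Poly_Mapping.single e c * q) = msubst \<phi> v (Poly_Mapping.single e c) * msubst \<phi> v q"
    for e c q
    by (induction q rule: mpol_induct)
      (auto simp: z add distrib_left mult_single msubst_single[OF assms] monom_val_add
        hom_distribs mult.assoc mult.left_commute)
  have mult: "msubst \<phi> v (p * q) = msubst \<phi> v p * msubst \<phi> v q" for p q
    by (induction p rule: mpol_induct) (auto simp: z add distrib_right mult1)
  have one: "msubst \<phi> v 1 = 1"
    using msubst_single[OF assms, of v 0 1] by simp
  show ?thesis
    by unfold_locales (auto simp: z add mult one)
qed

lemma id_hom: "comm_ring_hom (\<lambda>c::'k::comm_ring_1. c)"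
  by unfold_locales auto

lemma mev_hom: "comm_ring_hom (mev x)"
  unfolding mev_eq_msubst by (rule msubst_hom[OF id_hom])

lemma msubst_mvar:
  assumes "comm_ring_hom \<phi>"
  shows "msubst \<phi> v (mvar i) = v i"
proof -
  interpret comm_ring_hom \<phi> by fact
  show ?thesis by (simp add: mvar_def msubst_single[OF assms])
qed

lemma mev_mvar [simp]: "mev x (mvar i) = x i"
  by (simp add: mev_eq_msubst msubst_mvar[OF id_hom])

text \<open>Constant polynomials.\<close>

abbreviation mconst :: "'k::comm_ring_1 \<Rightarrow> ('i, 'k) mpol" where
  "mconst c \<equiv> Poly_Mapping.single 0 c"

lemma mconst_hom: "comm_ring_hom (mconst :: 'k::comm_ring_1 \<Rightarrow> ('i, 'k) mpol)"
  by unfold_locales (auto simp: single_add mult_single)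

lemma mev_mconst [simp]: "mev x (mconst c) = c"
  by (simp add: mev_eq_msubst msubst_single[OF id_hom])

lemma msubst_compose:
  assumes "comm_ring_hom \<psi>"
  shows "\<psi> (msubst \<phi> v p) = msubst (\<lambda>c. \<psi> (\<phi> c)) (\<lambda>i. \<psi> (v i)) p"
proof -
  interpret comm_ring_hom \<psi> by fact
  show ?thesis
    by (simp add: msubst_def hom_distribs monom_val_hom[OF assms])
qed

lemma monom_val_mvar: "monom_val mvar e = Poly_Mapping.single e (1::'k::comm_ring_1)"
proof -
  have "(\<Prod>i\<in>A. mvar i ^ Poly_Mapping.lookup e i) =
      Poly_Mapping.single (\<Sum>i\<in>A. Poly_Mapping.single i (Poly_Mapping.lookup e i)) (1::'k)"
    if "finite A" for A
    using that
  proof (induction rule: finite_induct)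
    case (insert i A)
    have "mvar i ^ n = Poly_Mapping.single (Poly_Mapping.single i n) (1::'k)" for n
      by (induction n) (auto simp: mvar_def mult_single simp flip: single_add)
    then show ?case
      using insert by (simp add: mult_single)
  qed simp
  from this[of "Poly_Mapping.keys e"] show ?thesis
    unfolding monom_val_def using mpol_sum_single[of e] by simp
qed

lemma msubst_mvar_id: "msubst mconst mvar p = p"
  unfolding msubst_def monom_val_mvar
  by (subst (3) mpol_sum_single) (simp add: mult_single)


section \<open>Degrees and graded families\<close>

lemma mdeg_superset:
  assumes "finite A" and "Poly_Mapping.keys e \<subseteq> A"
  shows "mdeg e = (\<Sum>i\<in>A. Poly_Mapping.lookup e i)"
  unfolding mdeg_def
  by (rule sum.mono_neutral_left[OF assms]) (auto simp: in_keys_iff)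

lemma mdeg_add: "mdeg (d + e) = mdeg d + mdeg e"
proof -
  let ?A = "Poly_Mapping.keys d \<union> Poly_Mapping.keys e"
  have "Poly_Mapping.keys (d + e) \<subseteq> ?A"
    by (rule keys_add)
  then show ?thesis
    by (simp add: mdeg_superset[of ?A] lookup_add sum.distrib)
qed

lemma mdeg_single [simp]: "mdeg (Poly_Mapping.single i n) = n"
  by (cases "n = 0") (auto simp: mdeg_def)

lemma mdeg_0 [simp]: "mdeg 0 = 0"
  by (simp add: mdeg_def)

lemma mdeg_eq_0_iff: "mdeg e = 0 \<longleftrightarrow> e = 0"
  by (auto simp: mdeg_def in_keys_iff intro: poly_mapping_eqI)

lemma lookup_le_mdeg: "Poly_Mapping.lookup e i \<le> mdeg e"
proof (cases "i \<in> Poly_Mapping.keys e")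
  case True
  then show ?thesis
    unfolding mdeg_def by (intro member_le_sum) auto
qed (simp add: in_keys_iff)

lemma lookup_eq_mdeg: "Poly_Mapping.lookup e i = mdeg e \<Longrightarrow> e = Poly_Mapping.single i (mdeg e)"
proof -
  assume i: "Poly_Mapping.lookup e i = mdeg e"
  define d where "d = e - Poly_Mapping.single i (mdeg e)"
  have e: "e = d + Poly_Mapping.single i (mdeg e)"
    using i by (intro poly_mapping_eqI) (auto simp: d_def lookup_add lookup_minus lookup_single when_def)
  have "mdeg e = mdeg d + mdeg e"
    by (subst e) (simp add: mdeg_add)
  then have "d = 0"
    by (simp add: mdeg_eq_0_iff)
  with e show ?thesis by simp
qed

text \<open>
  A graded family of subgroups \<open>A 0, A 1, \<dots>\<close> with \<open>A i \<cdot> A j \<subseteq> A (i + j)\<close>. The families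
  used are the forms of degree \<open>n\<close>, the forms of degree \<open>n\<close> in the \<open>n\<close>-th power of an ideal, and the
  families of polynomials in one more variable built from these.
\<close>

locale graded =
  fixes A :: "nat \<Rightarrow> 's::comm_ring_1 set"
  assumes zero_mem [simp]: "0 \<in> A n"
    and add_mem: "x \<in> A n \<Longrightarrow> y \<in> A n \<Longrightarrow> x + y \<in> A n"
    and uminus_mem: "x \<in> A n \<Longrightarrow> - x \<in> A n"
    and one_mem [simp]: "1 \<in> A 0"
    and mult_mem: "x \<in> A i \<Longrightarrow> y \<in> A j \<Longrightarrow> x * y \<in> A (i + j)"
begin

lemma sum_mem: "(\<And>i. i \<in> I \<Longrightarrow> f i \<in> A n) \<Longrightarrow> sum f I \<in> A n"
  by (induction I rule: infinite_finite_induct) (auto intro: add_mem)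

lemma prod_mem: "(\<And>i. i \<in> I \<Longrightarrow> f i \<in> A (d i)) \<Longrightarrow> prod f I \<in> A (sum d I)"
  by (induction I rule: infinite_finite_induct) (auto intro: mult_mem)

lemma power_mem: "x \<in> A d \<Longrightarrow> x ^ n \<in> A (n * d)"
  by (induction n) (auto intro: mult_mem)

lemma monom_val_mem:
  assumes "\<And>i. v i \<in> A 1"
  shows "monom_val v e \<in> A (mdeg e)"
  unfolding monom_val_def mdeg_def
  using power_mem[OF assms] by (intro prod_mem) auto

lemma msubst_mem:
  assumes v: "\<And>i. v i \<in> A 1" and c: "\<And>c. \<phi> c \<in> A 0" and p: "p \<in> forms n"
  shows "msubst \<phi> v p \<in> A n"
  unfolding msubst_def
proof (rule sum_mem)
  fix e assume "e \<in> Poly_Mapping.keys p"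
  then have "mdeg e = n"
    using p by (auto simp: forms_def)
  then show "\<phi> (Poly_Mapping.lookup p e) * monom_val v e \<in> A n"
    using mult_mem[OF c monom_val_mem[of v, OF v]] by force
qed

text \<open>
  A determinant whose entries are homogeneous of degree \<open>w i - s j\<close> is homogeneous of degree
  \<open>\<Sum>w - \<Sum>s\<close>.
\<close>

lemma det_mem:
  assumes M: "M \<in> carrier_mat n n"
    and entry: "\<And>i j. i < n \<Longrightarrow> j < n \<Longrightarrow> M $$ (i, j) \<noteq> 0 \<Longrightarrow> s j \<le> w i \<and> M $$ (i, j) \<in> A (w i - s j)"
  shows "det M \<in> A ((\<Sum>i<n. w i) - (\<Sum>j<n. s j))"
  unfolding det_def'[OF M]
proof (rule sum_mem)
  fix p assume "p \<in> {p. p permutes {0..<n}}"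
  then have p: "p permutes {0..<n}" by simp
  let ?P = "\<Prod>i = 0..<n. M $$ (i, p i)"
  have sgn: "signof p \<in> A 0"
    by (auto simp: sign_def intro: uminus_mem)
  have "?P \<in> A ((\<Sum>i<n. w i) - (\<Sum>j<n. s j))"
  proof (cases "\<exists>i<n. M $$ (i, p i) = 0")
    case True
    then have "?P = 0"
      by (intro prod_zero) auto
    then show ?thesis by simp
  next
    case False
    have pn: "p i < n" if "i < n" for i
      using permutes_in_image[OF p, of i] that by simp
    have le: "s (p i) \<le> w i \<and> M $$ (i, p i) \<in> A (w i - s (p i))" if "i < n" for i
      using entry[OF that pn[OF that]] False that by auto
    have "?P \<in> A (\<Sum>i = 0..<n. w i - s (p i))"
      using le by (intro prod_mem) auto
    also have "(\<Sum>i = 0..<n. w i - s (p i)) = (\<Sum>i = 0..<n. w i) - (\<Sum>i = 0..<n. s (p i))"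
      using le by (intro sum_subtractf_nat) auto
    also have "(\<Sum>i = 0..<n. s (p i)) = (\<Sum>j = 0..<n. s j)"
      using sum.permute[OF p, of s] by (simp add: o_def)
    finally show ?thesis
      by (simp add: atLeast0LessThan)
  qed
  from mult_mem[OF sgn this] show "signof p * ?P \<in> A ((\<Sum>i<n. w i) - (\<Sum>j<n. s j))"
    by simp
qed

end

text \<open>
  The polynomials \<open>\<Sum>\<^sub>j c\<^sub>j X\<^sup>j\<close> with \<open>c\<^sub>j\<close> in \<open>A (n - j)\<close>: the variable \<open>X\<close> gets degree \<open>1\<close>.
\<close>

definition graded_poly :: "(nat \<Rightarrow> 's::comm_ring_1 set) \<Rightarrow> nat \<Rightarrow> 's poly set" where
  "graded_poly A n = {q. \<forall>j. coeff q j \<noteq> 0 \<longrightarrow> j \<le> n \<and> coeff q j \<in> A (n - j)}"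

context graded
begin

lemma graded_poly: "graded (graded_poly A)"
proof
  fix i j and p q :: "'s poly"
  assume p: "p \<in> graded_poly A i" and q: "q \<in> graded_poly A j"
  have "k \<le> i + j \<and> coeff (p * q) k \<in> A (i + j - k)" if nz: "coeff (p * q) k \<noteq> 0" for k
  proof -
    have one: "k \<le> i + j \<and> coeff p l * coeff q (k - l) \<in> A (i + j - k)"
      if l: "l \<le> k" and nz: "coeff p l * coeff q (k - l) \<noteq> 0" for l
    proof -
      have "coeff p l \<noteq> 0" "coeff q (k - l) \<noteq> 0"
        using nz by auto
      then have *: "l \<le> i" "coeff p l \<in> A (i - l)" "k - l \<le> j" "coeff q (k - l) \<in> A (j - (k - l))"
        using p q by (auto simp: graded_poly_def)
      then have "i - l + (j - (k - l)) = i + j - k" "k \<le> i + j"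
        using l by auto
      then show ?thesis
        using mult_mem[OF *(2,4)] by simp
    qed
    from nz obtain l where "l \<le> k" "coeff p l * coeff q (k - l) \<noteq> 0"
      unfolding coeff_mult by (meson atMost_iff sum.neutral)
    with one have "k \<le> i + j" by blast
    moreover have "coeff (p * q) k \<in> A (i + j - k)"
      unfolding coeff_mult
    proof (rule sum_mem)
      fix l assume "l \<in> {..k}"
      then show "coeff p l * coeff q (k - l) \<in> A (i + j - k)"
        using one[of l] by (cases "coeff p l * coeff q (k - l) = 0") auto
    qed
    ultimately show ?thesis by simp
  qed
  then show "p * q \<in> graded_poly A (i + j)"
    by (auto simp: graded_poly_def)
next
  fix n and p q :: "'s poly"
  assume p: "p \<in> graded_poly A n" and q: "q \<in> graded_poly A n"
  have "j \<le> n \<and> coeff (p + q) j \<in> A (n - j)" if "coeff (p + q) j \<noteq> 0" for j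
  proof -
    have "coeff p j \<noteq> 0 \<or> coeff q j \<noteq> 0"
      using that by auto
    moreover have "coeff p j \<in> A (n - j)" "coeff q j \<in> A (n - j)"
      using p q zero_mem[of "n - j"] by (force simp: graded_poly_def)+
    ultimately show ?thesis
      using p q by (auto simp: graded_poly_def intro: add_mem)
  qed
  then show "p + q \<in> graded_poly A n"
    by (auto simp: graded_poly_def)
qed (auto simp: graded_poly_def coeff_1 intro: uminus_mem split: if_splits)

lemma linear_mem_graded_poly:
  assumes "c \<in> A 1" and "d \<in> A 0"
  shows "[:c, d:] \<in> graded_poly A 1"
  using assms by (auto simp: graded_poly_def coeff_pCons split: nat.splits)

lemma const_mem_graded_poly:
  assumes "c \<in> A n"
  shows "[:c:] \<in> graded_poly A n"
  using assms by (auto simp: graded_poly_def coeff_pCons split: nat.splits)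

end

lemma degree_graded_poly: "p \<in> graded_poly A n \<Longrightarrow> degree p \<le> n"
  unfolding graded_poly_def by (rule degree_le) (use linorder_not_less in blast)

lemma forms_add: "p \<in> forms n \<Longrightarrow> q \<in> forms n \<Longrightarrow> p + q \<in> forms n"
  using keys_add[of p q] by (auto simp: forms_def)

lemma forms_mult: "p \<in> forms i \<Longrightarrow> q \<in> forms j \<Longrightarrow> p * q \<in> forms (i + j)"
  using keys_mult[of p q] by (fastforce simp: forms_def mdeg_add)

lemma graded_forms: "graded (forms :: nat \<Rightarrow> ('i, 'k::comm_ring_1) mpol set)"
  by standard (auto simp: forms_add forms_mult, auto simp: forms_def in_keys_iff)

lemma mvar_mem_forms [simp]: "mvar i \<in> forms (Suc 0)"
  by (auto simp: forms_def mvar_def split: if_splits)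

lemma mconst_mem_forms [simp]: "mconst c \<in> forms 0"
  by (auto simp: forms_def split: if_splits)

lemma forms_0_const: "p \<in> forms 0 \<Longrightarrow> p = mconst (mev x p)"
proof -
  assume "p \<in> forms 0"
  then have "Poly_Mapping.keys p \<subseteq> {0}"
    by (auto simp: forms_def mdeg_eq_0_iff)
  then have "p = mconst (Poly_Mapping.lookup p 0)"
    by (intro poly_mapping_eqI) (auto simp: lookup_single when_def in_keys_iff)
  then show ?thesis
    by (metis mev_mconst)
qed

text \<open>Forms of degree \<open>n\<close> are homogeneous functions of degree \<open>n\<close>.\<close>

lemma msubst_scale:
  assumes "p \<in> forms n"
  shows "msubst \<phi> (\<lambda>i. c * v i) p = c ^ n * msubst \<phi> v p"
proof -
  have "monom_val (\<lambda>i. c * v i) e = c ^ mdeg e * monom_val v e" for e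
    by (simp add: monom_val_def mdeg_def power_mult_distrib prod.distrib power_sum)
  then show ?thesis
    using assms by (auto simp: msubst_def forms_def sum_distrib_left ac_simps intro!: sum.cong)
qed


section \<open>Subresultants\<close>

text \<open>
  The rows \<open>X\<^sup>i f\<close> for \<open>i < b - k\<close> and \<open>X\<^sup>j g\<close> for \<open>j < a - k\<close> of the Sylvester matrix for the
  \<open>k\<close>-th subresultant of polynomials \<open>f\<close>, \<open>g\<close> of formal degrees \<open>a\<close>, \<open>b\<close>.
\<close>

definition subres_row :: "nat \<Rightarrow> nat \<Rightarrow> 's::comm_ring_1 poly \<Rightarrow> 's poly \<Rightarrow> nat \<Rightarrow> 's poly" where
  "subres_row k b f g i = (if i < b - k then monom 1 i * f else monom 1 (i - (b - k)) * g)"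

text \<open>
  The matrix whose determinant \<open>subres_coeff k l\<close> is the coefficient of \<open>X\<^sup>l\<close>, for \<open>l \<le> k\<close>, in the
  \<open>k\<close>-th subresultant. Its columns are the coefficients of \<open>X\<^sup>l, X\<^sup>k\<^sup>+\<^sup>1, X\<^sup>k\<^sup>+\<^sup>2, \<dots>\<close> in the
  polynomials \<open>subres_row k b f g i\<close>.
\<close>

definition subres_mat ::
  "nat \<Rightarrow> nat \<Rightarrow> nat \<Rightarrow> nat \<Rightarrow> 's::comm_ring_1 poly \<Rightarrow> 's poly \<Rightarrow> 's mat" where
  "subres_mat k l a b f g = mat (a + b - 2 * k) (a + b - 2 * k)
     (\<lambda>(i, c). coeff (subres_row k b f g i) (if c = 0 then l else k + c))"

definition subres_coeff ::
  "nat \<Rightarrow> nat \<Rightarrow> nat \<Rightarrow> nat \<Rightarrow> 's::comm_ring_1 poly \<Rightarrow> 's poly \<Rightarrow> 's" where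
  "subres_coeff k l a b f g = det (subres_mat k l a b f g)"

lemma subres_mat_carrier [simp]:
  "subres_mat k l a b f g \<in> carrier_mat (a + b - 2 * k) (a + b - 2 * k)"
  by (simp add: subres_mat_def)

lemma degree_subres_row:
  assumes "degree f \<le> a" and "degree g \<le> b" and "i < a + b - 2 * k" and "k \<le> a" and "k \<le> b"
  shows "degree (subres_row k b f g i) < a + b - k"
proof (cases "i < b - k")
  case True
  then show ?thesis
    using degree_mult_le[of "monom 1 i" f] degree_monom_le[of "1::'a" i] assms
    by (simp add: subres_row_def)
next
  case False
  then show ?thesis
    using degree_mult_le[of "monom 1 (i - (b - k))" g] degree_monom_le[of "1::'a" "i - (b - k)"] assms
    by (simp add: subres_row_def)
qed

text \<open>
  The \<open>k\<close>-th subresultant has degree at most \<open>k\<close> and lies in the ideal generated by \<open>f\<close> and \<open>g\<close>: it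
  is the combination of the rows whose weights are the cofactors of the first column, and its
  coefficients of higher degree vanish as determinants with two equal columns, until the degrees
  of the rows are exceeded.
\<close>

lemma subres_bezout:
  fixes f g :: "'s::comm_ring_1 poly"
  assumes f: "degree f \<le> a" and g: "degree g \<le> b" and k: "k \<le> a" "k \<le> b" and pos: "2 * k < a + b"
  obtains u v where "u * f + v * g = (\<Sum>l\<le>k. monom (subres_coeff k l a b f g) l)"
proof -
  define N where "N = a + b - 2 * k"
  have N: "0 < N"
    using pos by (simp add: N_def)
  define r where "r = subres_row k b f g"
  define \<kappa> where "\<kappa> i = cofactor (subres_mat k k a b f g) i 0" for i
  define S where "S = (\<Sum>i<N. Polynomial.smult (\<kappa> i) (r i))"
  have coeff_S: "coeff S l = subres_coeff k l a b f g" for l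
  proof -
    have del: "mat_delete (subres_mat k l a b f g) i 0 = mat_delete (subres_mat k k a b f g) i 0" for i
      by (rule eq_matI) (auto simp: subres_mat_def mat_delete_def)
    have cof: "cofactor (subres_mat k l a b f g) i 0 = \<kappa> i" for i
      by (simp add: \<kappa>_def cofactor_def del)
    have entry: "subres_mat k l a b f g $$ (i, 0) = coeff (r i) l" if "i < N" for i
      using that N by (simp add: subres_mat_def r_def N_def)
    have "subres_coeff k l a b f g =
        (\<Sum>i<N. subres_mat k l a b f g $$ (i, 0) * cofactor (subres_mat k l a b f g) i 0)"
      unfolding subres_coeff_def
      by (rule laplace_expansion_column) (use N in \<open>simp_all add: N_def\<close>)
    also have "\<dots> = (\<Sum>i<N. \<kappa> i * coeff (r i) l)"
      by (intro sum.cong) (simp_all add: cof entry mult.commute)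
    finally show ?thesis
      by (simp add: S_def coeff_sum)
  qed
  have high: "coeff S l = 0" if l: "l > k" for l
  proof (cases "l < k + N")
    case True
    have "det (subres_mat k l a b f g) = 0"
    proof (rule det_identical_columns)
      show "subres_mat k l a b f g \<in> carrier_mat N N"
        by (simp add: N_def)
      show "(0::nat) \<noteq> l - k" "0 < N" "l - k < N"
        using l True by auto
      show "col (subres_mat k l a b f g) 0 = col (subres_mat k l a b f g) (l - k)"
        using l True by (intro eq_vecI) (auto simp: subres_mat_def N_def)
    qed
    then show ?thesis
      by (simp add: coeff_S subres_coeff_def)
  next
    case False
    have "coeff (r i) l = 0" if "i < N" for i
    proof (rule coeff_eq_0)
      have "degree (r i) < a + b - k"
        using that unfolding r_def N_def by (intro degree_subres_row f g k)
      also have "\<dots> \<le> l"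
        using False k by (simp add: N_def)
      finally show "degree (r i) < l" .
    qed
    then show ?thesis
      by (simp add: S_def coeff_sum)
  qed
  have "S = (\<Sum>l\<le>k. monom (subres_coeff k l a b f g) l)"
    by (rule poly_eqI) (auto simp: coeff_sum coeff_S[symmetric] high sum.delta' not_le)
  moreover have "\<exists>u v. S = u * f + v * g"
  proof -
    have "\<exists>u v. (\<Sum>i\<in>I. Polynomial.smult (\<kappa> i) (r i)) = u * f + v * g" if "finite I" for I
      using that
    proof (induction rule: finite_induct)
      case empty
      show ?case
        by (rule exI[of _ 0], rule exI[of _ 0]) simp
    next
      case (insert i I)
      then obtain u v where "(\<Sum>i\<in>I. Polynomial.smult (\<kappa> i) (r i)) = u * f + v * g" by blast
      moreover have "\<exists>u v. Polynomial.smult (\<kappa> i) (r i) = u * f + v * g"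
      proof (cases "i < b - k")
        case True
        then have "Polynomial.smult (\<kappa> i) (r i) = Polynomial.smult (\<kappa> i) (monom 1 i) * f + 0 * g"
          by (simp add: r_def subres_row_def)
        then show ?thesis by blast
      next
        case False
        then have "Polynomial.smult (\<kappa> i) (r i) = 0 * f + Polynomial.smult (\<kappa> i) (monom 1 (i - (b - k))) * g"
          by (simp add: r_def subres_row_def)
        then show ?thesis by blast
      qed
      then obtain u' v' where "Polynomial.smult (\<kappa> i) (r i) = u' * f + v' * g" by blast
      ultimately have "(\<Sum>i\<in>insert i I. Polynomial.smult (\<kappa> i) (r i)) = (u' + u) * f + (v' + v) * g"
        using insert.hyps by (simp add: algebra_simps)
      then show ?case by blast
    qed
    then show ?thesis
      by (simp add: S_def)
  qed
  ultimately show ?thesis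
    using that by metis
qed

lemma (in graded) subres_coeff_mem:
  assumes f: "f \<in> graded_poly A a" and g: "g \<in> graded_poly A b"
    and k: "k \<le> a" "k \<le> b" and pos: "2 * k < a + b" and l: "l \<le> k"
  shows "subres_coeff k l a b f g \<in> A ((a - k) * (b - k) + (k - l))"
proof -
  interpret P: graded "graded_poly A" by (rule graded_poly)
  define p q where "p = a - k" and "q = b - k"
  have ab: "a = p + k" "b = q + k"
    using k by (auto simp: p_def q_def)
  define w where "w i = (if i < q then a + i else b + (i - q))" for i
  define s where "s c = (if c = 0 then l else k + c)" for c
  have N: "a + b - 2 * k = p + q" and pq: "0 < p + q"
    using pos by (auto simp: ab)
  have mon: "monom 1 i \<in> graded_poly A i" for i
    by (auto simp: graded_poly_def)
  have row: "subres_row k b f g i \<in> graded_poly A (w i)" for i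
    using P.mult_mem[OF mon[of i] f] P.mult_mem[OF mon[of "i - q"] g]
    by (auto simp: subres_row_def w_def q_def add.commute)
  have split: "(\<Sum>i<m + n. h i) = (\<Sum>i<m. h i) + (\<Sum>i<n. h (m + i))" for m n and h :: "nat \<Rightarrow> nat"
    by (induction n) (auto simp: add.assoc)
  have "(\<Sum>i<p + q. w i) = (\<Sum>i<q. p + (k + i)) + (\<Sum>j<p. q + (k + j))"
    using split[of w q p] by (simp add: w_def ab algebra_simps)
  also have "\<dots> = p * q + ((\<Sum>j<p. k + j) + (\<Sum>i<q. k + (p + i))) "
    by (simp add: sum.distrib algebra_simps)
  also have "\<dots> = p * q + (\<Sum>c<p + q. k + c)"
    by (simp only: split[of "\<lambda>c. k + c" p q])
  finally have w_sum: "(\<Sum>i<p + q. w i) = p * q + (\<Sum>c<p + q. k + c)" .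
  obtain N' where N': "p + q = Suc N'"
    using pq by (cases "p + q") auto
  have s_sum: "(\<Sum>c<p + q. s c) + (k - l) = (\<Sum>c<p + q. k + c)"
    using l unfolding N' by (simp add: s_def sum.lessThan_Suc_shift del: sum.lessThan_Suc)
  have "subres_coeff k l a b f g \<in> A ((\<Sum>i<p + q. w i) - (\<Sum>c<p + q. s c))"
    unfolding subres_coeff_def
  proof (rule det_mem)
    show "subres_mat k l a b f g \<in> carrier_mat (p + q) (p + q)"
      by (metis N subres_mat_carrier)
    fix i j assume "i < p + q" "j < p + q" "subres_mat k l a b f g $$ (i, j) \<noteq> 0"
    then show "s j \<le> w i \<and> subres_mat k l a b f g $$ (i, j) \<in> A (w i - s j)"
      using row[of i] by (auto simp: subres_mat_def N s_def graded_poly_def)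
  qed
  also have "(\<Sum>i<p + q. w i) - (\<Sum>c<p + q. s c) = p * q + (k - l)"
    using w_sum s_sum by linarith
  finally show ?thesis
    by (simp add: p_def q_def)
qed

lemma subres_coeff_hom:
  assumes "comm_ring_hom \<psi>"
  shows "\<psi> (subres_coeff k l a b f g) = subres_coeff k l a b (map_poly \<psi> f) (map_poly \<psi> g)"
proof -
  interpret comm_ring_hom \<psi> by fact
  interpret mp: map_poly_comm_ring_hom \<psi> ..
  have row: "map_poly \<psi> (subres_row k b f g i) = subres_row k b (map_poly \<psi> f) (map_poly \<psi> g) i" for i
    by (simp add: subres_row_def hom_distribs)
  have "map_mat \<psi> (subres_mat k l a b f g) = subres_mat k l a b (map_poly \<psi> f) (map_poly \<psi> g)"
    by (rule eq_matI) (auto simp: subres_mat_def row[symmetric] coeff_map_poly)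
  then show ?thesis
    by (metis hom_det subres_coeff_def)
qed

text \<open>When the rows are the powers \<open>X\<^sup>k, X\<^sup>k\<^sup>+\<^sup>1, \<dots>\<close>, the matrix is the identity.\<close>

lemma subres_coeff_monom:
  assumes "k \<le> a" and "k \<le> b"
  shows "subres_coeff k k a b (monom 1 k) (monom (1::'s::comm_ring_1) b) = 1"
proof -
  have "subres_mat k k a b (monom 1 k) (monom (1::'s) b) = 1\<^sub>m (a + b - 2 * k)"
    using assms
    by (intro eq_matI) (auto simp: subres_mat_def subres_row_def mult_monom)
  then show ?thesis
    by (simp add: subres_coeff_def)
qed


section \<open>Restriction to a line\<close>

text \<open>
  The polynomial \<open>F(v + X w)\<close> in one variable \<open>X\<close>, the restriction of \<open>F\<close> to a line; \<open>\<kappa>\<close> embeds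
  the coefficients of \<open>F\<close> into the ring that contains the coordinates of \<open>v\<close> and \<open>w\<close>.
\<close>

definition line ::
  "('k::comm_ring_1 \<Rightarrow> 's::comm_ring_1) \<Rightarrow> ('i \<Rightarrow> 's) \<Rightarrow> ('i \<Rightarrow> 's) \<Rightarrow> ('i, 'k) mpol \<Rightarrow> 's poly" where
  "line \<kappa> v w = msubst (\<lambda>c. [:\<kappa> c:]) (\<lambda>i. [:v i, w i:])"

lemma const_poly_hom:
  assumes "comm_ring_hom \<kappa>"
  shows "comm_ring_hom (\<lambda>c. [:\<kappa> c:])"
proof -
  interpret comm_ring_hom \<kappa> by fact
  show ?thesis
    by unfold_locales (auto simp: hom_distribs one_pCons)
qed

lemma line_hom: "comm_ring_hom \<kappa> \<Longrightarrow> comm_ring_hom (line \<kappa> v w)"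
  unfolding line_def by (intro msubst_hom const_poly_hom)

lemma map_poly_line:
  assumes "comm_ring_hom \<psi>"
  shows "map_poly \<psi> (line \<kappa> v w F) = line (\<lambda>c. \<psi> (\<kappa> c)) (\<lambda>i. \<psi> (v i)) (\<lambda>i. \<psi> (w i)) F"
proof -
  interpret comm_ring_hom \<psi> by fact
  interpret mp: map_poly_comm_ring_hom \<psi> ..
  have hom: "comm_ring_hom (map_poly \<psi>)" ..
  have lin: "map_poly \<psi> [:a, b:] = [:\<psi> a, \<psi> b:]" for a b
    by (rule poly_eqI) (simp add: coeff_map_poly coeff_pCons split: nat.splits)
  show ?thesis
    using lin[of _ 0] by (simp add: line_def msubst_compose[OF hom] lin)
qed

lemma poly_line: "poly (line \<kappa> v w F) z = msubst \<kappa> (\<lambda>i. v i + z * w i) F"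
proof -
  have hom: "comm_ring_hom (\<lambda>p. poly p z)"
    by unfold_locales auto
  show ?thesis
    by (simp add: line_def msubst_compose[OF hom])
qed

lemma line_mvar: "comm_ring_hom \<kappa> \<Longrightarrow> line \<kappa> v w (mvar i) = [:v i, w i:]"
  unfolding line_def by (intro msubst_mvar const_poly_hom)

lemma (in graded) line_mem:
  assumes "\<And>c. \<kappa> c \<in> A 0" and "\<And>i. v i \<in> A 1" and "\<And>i. w i \<in> A 0" and "F \<in> forms n"
  shows "line \<kappa> v w F \<in> graded_poly A n"
proof -
  interpret P: graded "graded_poly A" by (rule graded_poly)
  show ?thesis
    unfolding line_def
    by (intro P.msubst_mem linear_mem_graded_poly const_mem_graded_poly assms)
qed


section \<open>Regular sequences from a resultant\<close>

lemma division_unit_lead_coeff: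
  fixes g h :: "'t::idom poly"
  assumes "lead_coeff g dvd 1"
  obtains q r where "h = g * q + r" and "r = 0 \<or> degree r < degree g"
proof -
  have g: "g \<noteq> 0"
    using assms by auto
  obtain q r where qr: "pseudo_divmod h g = (q, r)"
    by fastforce
  obtain c where c: "lead_coeff g ^ (Suc (degree h) - degree g) * c = 1"
    using assms by (metis dvd_def dvd_power_same power_one)
  from pseudo_divmod(1)[OF g qr]
  have "Polynomial.smult c (g * q + r) = h"
    using c by (metis mult.commute smult_1_left smult_smult)
  then have "h = g * Polynomial.smult c q + Polynomial.smult c r"
    by (simp add: smult_add_right)
  moreover have "Polynomial.smult c r = 0 \<or> degree (Polynomial.smult c r) < degree g"
    using pseudo_divmod(2)[OF g qr] degree_smult_le[of c r] by fastforce
  ultimately show ?thesis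
    using that by blast
qed

lemma small_multiple_zero:
  fixes g r w :: "'t::idom poly"
  assumes "Polynomial.smult \<rho> r = g * w" and "\<rho> \<noteq> 0" and "g \<noteq> 0"
    and "r = 0 \<or> degree r < degree g"
  shows "r = 0"
proof (rule ccontr)
  assume r: "r \<noteq> 0"
  then have "g * w \<noteq> 0"
    using assms by (metis smult_eq_0_iff)
  then have "degree g \<le> degree (g * w)"
    by (auto simp: degree_mult_eq)
  also have "\<dots> = degree r"
    using assms(1,2) by (metis degree_smult_eq)
  finally show False
    using assms(4) r by auto
qed

text \<open>
  A nonzero constant \<open>\<rho>\<close> in the ideal \<open>(f, g)\<close>, such as the resultant, replaces coprimality: modulo
  \<open>g\<close> every polynomial has a unique remainder, and \<open>\<rho>\<close> acts on remainders without torsion.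
\<close>

lemma regular_pair:
  fixes f g h :: "'t::idom poly"
  assumes lc: "lead_coeff g dvd 1" and bez: "u * f + v * g = [:\<rho>:]" and \<rho>: "\<rho> \<noteq> 0"
    and eq: "g * h = p * f"
  obtains q where "h = q * f"
proof -
  obtain q r where qr: "p = g * q + r" "r = 0 \<or> degree r < degree g"
    using division_unit_lead_coeff[OF lc] .
  have g: "g \<noteq> 0"
    using lc by auto
  have "Polynomial.smult \<rho> p = (u * f + v * g) * p"
    by (simp add: bez)
  also have "\<dots> = g * (u * h + v * p)"
    using eq by (simp add: algebra_simps)
  finally have "Polynomial.smult \<rho> r = g * (u * h + v * p - Polynomial.smult \<rho> q)"
    by (simp add: qr(1) algebra_simps smult_add_right)
  then have "r = 0"
    using \<rho> g qr(2) by (rule small_multiple_zero)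
  then have "g * h = g * (q * f)"
    using eq qr by simp
  with g have "h = q * f" by simp
  with that show ?thesis by blast
qed

text \<open>
  If a constant \<open>\<rho>\<close> in the ideal \<open>(f, g)\<close>, such as the resultant, stays nonzero modulo \<open>\<pi>\<close>, then
  \<open>\<pi>\<close> is not a zero divisor modulo \<open>(f, g)\<close>. The homomorphism \<open>\<phi>\<close> is the reduction modulo \<open>\<pi>\<close>.
\<close>

lemma regular_triple:
  fixes f g h :: "'t::idom poly" and \<phi> :: "'t \<Rightarrow> 's::idom"
  assumes hom: "comm_ring_hom \<phi>" and ker: "\<And>x. \<phi> x = 0 \<Longrightarrow> \<pi> dvd x" and \<pi>: "\<phi> \<pi> = 0" "\<pi> \<noteq> 0"
    and lc: "lead_coeff g dvd 1" and bez: "u * f + v * g = [:\<rho>:]" and \<rho>: "\<phi> \<rho> \<noteq> 0"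
    and eq: "[:\<pi>:] * h = p * f + q * g"
  obtains p' q' where "h = p' * f + q' * g"
proof -
  interpret comm_ring_hom \<phi> by fact
  interpret mp: map_poly_comm_ring_hom \<phi> ..
  let ?\<phi> = "map_poly \<phi>"
  have ker': "\<exists>y. x = [:\<pi>:] * y" if "?\<phi> x = 0" for x
  proof -
    have "\<pi> dvd coeff x i" for i
      using that by (intro ker) (metis coeff_0 coeff_map_poly hom_zero)
    then show ?thesis
      by (metis const_poly_dvd_iff dvdE)
  qed
  have \<pi>0: "?\<phi> [:\<pi>:] = 0"
    by (simp add: \<pi>)
  have "\<phi> (lead_coeff g) dvd 1"
    using lc by (metis hom_dvd hom_one)
  then have lc': "\<phi> (lead_coeff g) \<noteq> 0"
    by auto
  then have "degree g \<le> degree (?\<phi> g)"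
    by (intro le_degree) (simp add: coeff_map_poly)
  then have deg: "degree (?\<phi> g) = degree g"
    using degree_map_poly_le[of \<phi> g] by simp
  have g0: "?\<phi> g \<noteq> 0"
    using lc' by (metis coeff_0 coeff_map_poly hom_zero)
  obtain s r where sr: "p = g * s + r" "r = 0 \<or> degree r < degree g"
    using division_unit_lead_coeff[OF lc] .
  have "Polynomial.smult \<rho> p = (u * f + v * g) * p"
    by (simp add: bez)
  also have "\<dots> = u * (p * f) + g * (v * p)"
    by (simp add: algebra_simps)
  also have "p * f = [:\<pi>:] * h - q * g"
    using eq by simp
  finally have "Polynomial.smult \<rho> r = [:\<pi>:] * (u * h) + g * (v * p - u * q - Polynomial.smult \<rho> s)"
    by (simp add: sr(1) algebra_simps smult_add_right smult_diff_right)
  then have "?\<phi> (Polynomial.smult \<rho> r) =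
      ?\<phi> [:\<pi>:] * ?\<phi> (u * h) + ?\<phi> g * ?\<phi> (v * p - u * q - Polynomial.smult \<rho> s)"
    by (simp only: mp.hom_add mp.hom_mult)
  then have "Polynomial.smult (\<phi> \<rho>) (?\<phi> r) = ?\<phi> g * ?\<phi> (v * p - u * q - Polynomial.smult \<rho> s)"
    by (simp add: hom_distribs \<pi>)
  moreover have "?\<phi> r = 0 \<or> degree (?\<phi> r) < degree (?\<phi> g)"
    using sr(2) degree_map_poly_le[of \<phi> r] by (auto simp: deg)
  ultimately have "?\<phi> r = 0"
    using \<rho> g0 by (intro small_multiple_zero)
  then obtain r' where r': "r = [:\<pi>:] * r'"
    using ker' by blast
  have eq': "[:\<pi>:] * (h - r' * f) = g * (s * f + q)"
    using eq unfolding sr(1) r' by (simp only: algebra_simps)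
  then have "?\<phi> g * ?\<phi> (s * f + q) = 0"
    by (metis \<pi>0 mp.hom_mult mult_zero_left)
  then have "?\<phi> (s * f + q) = 0"
    using g0 by simp
  then obtain t where t: "s * f + q = [:\<pi>:] * t"
    using ker' by blast
  have "[:\<pi>:] * (h - r' * f) = [:\<pi>:] * (g * t)"
    unfolding eq' t by (simp only: ac_simps)
  then have "h - r' * f = g * t"
    using \<pi>(2) by (metis mult_left_cancel pCons_eq_0_iff)
  then have "h = r' * f + t * g"
    by (simp add: algebra_simps)
  then show ?thesis
    using that by blast
qed


section \<open>Ideals and their powers\<close>

lemma gen_ideal_superset: "x \<in> S \<Longrightarrow> x \<in> gen_ideal S"
  unfolding gen_ideal_def by (rule module.span_base[OF module_times])

lemma gen_ideal_0 [simp]: "0 \<in> gen_ideal S"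
  unfolding gen_ideal_def by (rule module.span_zero[OF module_times])

lemma gen_ideal_add: "x \<in> gen_ideal S \<Longrightarrow> y \<in> gen_ideal S \<Longrightarrow> x + y \<in> gen_ideal S"
  unfolding gen_ideal_def by (rule module.span_add[OF module_times])

lemma gen_ideal_mult: "x \<in> gen_ideal S \<Longrightarrow> c * x \<in> gen_ideal S"
  unfolding gen_ideal_def by (rule module.span_scale[OF module_times])

lemma gen_ideal_induct [consumes 1, case_names zero add_mult]:
  assumes "x \<in> gen_ideal S" and "P 0" and "\<And>c s y. s \<in> S \<Longrightarrow> P y \<Longrightarrow> P (c * s + y)"
  shows "P x"
  using assms unfolding gen_ideal_def by (rule module.span_induct_alt[OF module_times])

lemma gen_ideal_empty: "gen_ideal {} = {0}"
  unfolding gen_ideal_def by (rule module.span_empty[OF module_times])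

lemma gen_ideal_pair: "gen_ideal {f, g} = {p * f + q * g | p q. True}"
proof (intro equalityI subsetI)
  fix x assume "x \<in> gen_ideal {f, g}"
  then show "x \<in> {p * f + q * g | p q. True}"
  proof (induction rule: gen_ideal_induct)
    case zero
    have "0 = 0 * f + 0 * g" by simp
    then show ?case by blast
  next
    case (add_mult c s y)
    then obtain p q where "y = p * f + q * g" by blast
    then have "c * f + y = (c + p) * f + q * g" "c * g + y = p * f + (c + q) * g"
      by (simp_all add: algebra_simps)
    with add_mult.hyps show ?case by blast
  qed
next
  fix x assume "x \<in> {p * f + q * g | p q. True}"
  then obtain p q where "x = p * f + q * g" by blast
  moreover have "f \<in> gen_ideal {f, g}" "g \<in> gen_ideal {f, g}"
    by (auto intro: gen_ideal_superset)
  ultimately show "x \<in> gen_ideal {f, g}"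
    by (simp add: gen_ideal_add gen_ideal_mult)
qed

lemma gen_ideal_single: "gen_ideal {f} = {p * f | p. True}"
proof (intro equalityI subsetI)
  fix x assume "x \<in> gen_ideal {f}"
  then obtain p q where "x = p * f + q * f"
    using gen_ideal_pair[of f f] by auto
  then have "x = (p + q) * f"
    by (simp add: distrib_right)
  then show "x \<in> {p * f | p. True}" by blast
next
  fix x assume "x \<in> {p * f | p. True}"
  then obtain p where "x = p * f" by blast
  then show "x \<in> gen_ideal {f}"
    by (simp add: gen_ideal_mult gen_ideal_superset)
qed

lemma idl_power_0_mem [simp]: "0 \<in> idl_power I n"
  by (cases n) auto

lemma idl_power_add: "x \<in> idl_power I n \<Longrightarrow> y \<in> idl_power I n \<Longrightarrow> x + y \<in> idl_power I n"
  by (cases n) (auto intro: gen_ideal_add)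

lemma idl_power_ideal: "x \<in> idl_power I n \<Longrightarrow> c * x \<in> idl_power I n"
  by (cases n) (auto intro: gen_ideal_mult)

lemma idl_power_SucI:
  assumes "f \<in> I" and "g \<in> idl_power I n"
  shows "f * g \<in> idl_power I (Suc n)"
proof -
  have "f * g \<in> {f * g | f g. f \<in> I \<and> g \<in> idl_power I n}"
    using assms by blast
  then show ?thesis
    by (simp add: gen_ideal_superset)
qed

lemma idl_power_mult: "x \<in> idl_power I i \<Longrightarrow> y \<in> idl_power I j \<Longrightarrow> x * y \<in> idl_power I (i + j)"
proof (induction i arbitrary: x)
  case 0
  then show ?case by (simp add: idl_power_ideal)
next
  case (Suc i)
  from Suc.prems(1) have "x \<in> gen_ideal {f * g | f g. f \<in> I \<and> g \<in> idl_power I i}"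
    by simp
  then show ?case
  proof (induction rule: gen_ideal_induct)
    case (add_mult c s z)
    then obtain f g where fg: "s = f * g" "f \<in> I" "g \<in> idl_power I i" by blast
    then have "f * (g * y) \<in> idl_power I (Suc i + j)"
      using idl_power_SucI[OF fg(2) Suc.IH[OF fg(3) Suc.prems(2)]] by simp
    then have "c * (f * (g * y)) \<in> idl_power I (Suc i + j)"
      by (rule idl_power_ideal)
    then have "c * (f * (g * y)) + z * y \<in> idl_power I (Suc i + j)"
      using add_mult.IH by (rule idl_power_add)
    moreover have "(c * s + z) * y = c * (f * (g * y)) + z * y"
      by (simp add: fg(1) distrib_right mult.assoc)
    ultimately show ?case
      by (simp only:)
  qed (simp only: mult_zero_left idl_power_0_mem)
qed

lemma power_mem_idl_power: "x \<in> I \<Longrightarrow> x ^ n \<in> idl_power I n"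
  by (induction n) (simp_all add: idl_power_SucI del: idl_power.simps(2))

lemma mem_idl_power_1: "x \<in> I \<Longrightarrow> x \<in> idl_power I 1"
  using power_mem_idl_power[of x I 1] by simp

lemma idl_power_Suc_subset: "x \<in> idl_power I (Suc n) \<Longrightarrow> x \<in> idl_power I n"
proof -
  assume "x \<in> idl_power I (Suc n)"
  then have "x \<in> gen_ideal {f * g | f g. f \<in> I \<and> g \<in> idl_power I n}" by simp
  then show ?thesis
  proof (induction rule: gen_ideal_induct)
    case (add_mult c s y)
    then obtain f g where "s = f * g" "g \<in> idl_power I n" by blast
    with add_mult.IH show ?case
      by (simp add: idl_power_add idl_power_ideal)
  qed simp
qed

text \<open>The forms of degree \<open>n\<close> in the \<open>n\<close>-th power of an ideal.\<close>

lemma graded_forms_idl_power: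
  "graded (\<lambda>n. (forms n :: ('i, 'k::comm_ring_1) mpol set) \<inter> idl_power I n)"
proof -
  interpret F: graded "forms :: nat \<Rightarrow> ('i, 'k) mpol set" by (rule graded_forms)
  show ?thesis
  proof
    fix n and x :: "('i, 'k) mpol"
    assume "x \<in> forms n \<inter> idl_power I n"
    then show "- x \<in> forms n \<inter> idl_power I n"
      using idl_power_ideal[of x I n "- 1"] by (auto intro: F.uminus_mem)
  qed (auto intro: F.add_mem F.mult_mem idl_power_add idl_power_mult)
qed


section \<open>Counting monomials\<close>

lemma UNIV_4: "(UNIV :: 4 set) = {0, 1, 2, 3}"
  by (rule sym, rule card_subset_eq) simp_all

lemma mdeg_4:
  fixes e :: "4 \<Rightarrow>\<^sub>0 nat"
  shows "mdeg e = Poly_Mapping.lookup e 0 + Poly_Mapping.lookup e 1 + Poly_Mapping.lookup e 2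
    + Poly_Mapping.lookup e 3"
proof -
  have "Poly_Mapping.keys e \<subseteq> {0, 1, 2, 3}"
    using UNIV_4 by blast
  from mdeg_superset[OF _ this] show ?thesis
    by simp
qed

lemma bij_betw_exponents_lists:
  "bij_betw (\<lambda>e::4 \<Rightarrow>\<^sub>0 nat. [Poly_Mapping.lookup e 0, Poly_Mapping.lookup e 1,
      Poly_Mapping.lookup e 2, Poly_Mapping.lookup e 3])
    {e. mdeg e = n} {l. length l = 4 \<and> sum_list l = n}"
proof (rule bij_betwI')
  fix d e :: "4 \<Rightarrow>\<^sub>0 nat"
  have "d = e \<longleftrightarrow> (\<forall>i\<in>UNIV. Poly_Mapping.lookup d i = Poly_Mapping.lookup e i)"
    by (auto intro: poly_mapping_eqI)
  then show "([Poly_Mapping.lookup d 0, Poly_Mapping.lookup d 1, Poly_Mapping.lookup d 2,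
        Poly_Mapping.lookup d 3] = [Poly_Mapping.lookup e 0, Poly_Mapping.lookup e 1,
        Poly_Mapping.lookup e 2, Poly_Mapping.lookup e 3]) = (d = e)"
    unfolding UNIV_4 by auto
next
  fix l :: "nat list"
  assume "l \<in> {l. length l = 4 \<and> sum_list l = n}"
  then obtain x0 x1 x2 x3 where l: "l = [x0, x1, x2, x3]" "x0 + x1 + x2 + x3 = n"
    by (auto simp: length_Suc_conv numeral_eq_Suc)
  define e :: "4 \<Rightarrow>\<^sub>0 nat" where
    "e = Abs_poly_mapping (\<lambda>i. if i = 0 then x0 else if i = 1 then x1 else if i = 2 then x2 else x3)"
  have "Poly_Mapping.lookup e =
      (\<lambda>i. if i = 0 then x0 else if i = 1 then x1 else if i = 2 then x2 else x3)"
    unfolding e_def by (rule lookup_Abs_poly_mapping) simp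
  then show "\<exists>e\<in>{e::4 \<Rightarrow>\<^sub>0 nat. mdeg e = n}. l = [Poly_Mapping.lookup e 0, Poly_Mapping.lookup e 1,
      Poly_Mapping.lookup e 2, Poly_Mapping.lookup e 3]"
    using l by (intro bexI[of _ e]) (auto simp: mdeg_4)
qed (auto simp: mdeg_4)

lemma card_exponents: "card {e::4 \<Rightarrow>\<^sub>0 nat. mdeg e = n} = (n + 3) choose 3"
  using bij_betw_same_card[OF bij_betw_exponents_lists[of n]] binomial_symmetric[of n "n + 3"]
  by (simp add: card_length_sum_list add.commute)

lemma finite_exponents: "finite {e::4 \<Rightarrow>\<^sub>0 nat. mdeg e = n}"
  using card_exponents[of n] by (intro card_ge_0_finite) (simp add: zero_less_binomial)

lemma card_exponents_bounded:
  fixes i :: 4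
  shows "card {e. mdeg e = n \<and> Poly_Mapping.lookup e i < b} + ((n + 3 - b) choose 3) = (n + 3) choose 3"
proof -
  let ?E = "{e::4 \<Rightarrow>\<^sub>0 nat. mdeg e = n \<and> Poly_Mapping.lookup e i < b}"
  let ?H = "{e::4 \<Rightarrow>\<^sub>0 nat. mdeg e = n \<and> b \<le> Poly_Mapping.lookup e i}"
  have "card ?H = (n + 3 - b) choose 3"
  proof (cases "b \<le> n")
    case True
    let ?s = "\<lambda>e. e + Poly_Mapping.single i b"
    have "?H = ?s ` {e. mdeg e = n - b}"
    proof (intro equalityI subsetI)
      fix e assume e: "e \<in> ?H"
      let ?d = "e - Poly_Mapping.single i b"
      have eq: "e = ?s ?d"
        using e by (intro poly_mapping_eqI) (auto simp: lookup_add lookup_minus lookup_single when_def)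
      have "mdeg e = mdeg ?d + b"
        by (subst eq) (simp add: mdeg_add)
      moreover have "mdeg e = n"
        using e by simp
      ultimately have "mdeg ?d = n - b"
        by linarith
      with eq show "e \<in> ?s ` {e. mdeg e = n - b}" by blast
    qed (use True in \<open>auto simp: mdeg_add lookup_add\<close>)
    moreover have "inj_on ?s {e. mdeg e = n - b}"
      by (rule inj_onI) simp
    ultimately show ?thesis
      using True by (simp add: card_image card_exponents)
  next
    case False
    have "?H = {}"
    proof (intro equalityI subsetI)
      fix e assume "e \<in> ?H"
      with False lookup_le_mdeg[of e i] show "e \<in> {}" by simp
    qed simp
    then have "card ?H = 0"
      by (simp only: card.empty)
    with False show ?thesis
      by (simp add: binomial_eq_0)
  qed
  moreover have "{e::4 \<Rightarrow>\<^sub>0 nat. mdeg e = n} = ?E \<union> ?H" "?E \<inter> ?H = {}"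
    by auto
  then have "card {e::4 \<Rightarrow>\<^sub>0 nat. mdeg e = n} = card ?E + card ?H"
    using finite_exponents[of n] by (metis (no_types, lifting) card_Un_disjoint finite_Un)
  ultimately show ?thesis
    by (simp add: card_exponents)
qed


section \<open>The dimension of a homogeneous component of an ideal with two generators\<close>

text \<open>The homogeneous component of degree \<open>n\<close>.\<close>

definition hcomp :: "nat \<Rightarrow> ('i, 'k::comm_ring_1) mpol \<Rightarrow> ('i, 'k) mpol" where
  "hcomp n p = (\<Sum>e\<in>{e\<in>Poly_Mapping.keys p. mdeg e = n}. Poly_Mapping.single e (Poly_Mapping.lookup p e))"

lemma lookup_hcomp: "Poly_Mapping.lookup (hcomp n p) e = (if mdeg e = n then Poly_Mapping.lookup p e else 0)"
  by (auto simp: hcomp_def lookup_sum lookup_single when_def in_keys_iff sum.delta')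

lemma hcomp_add: "hcomp n (p + q) = hcomp n p + hcomp n q"
  by (rule poly_mapping_eqI) (simp add: lookup_hcomp lookup_add)

lemma hcomp_0 [simp]: "hcomp n 0 = 0"
  by (rule poly_mapping_eqI) (simp add: lookup_hcomp)

lemma hcomp_mem: "hcomp n p \<in> forms n"
  by (auto simp: forms_def in_keys_iff lookup_hcomp split: if_splits)

lemma hcomp_forms: "p \<in> forms d \<Longrightarrow> hcomp n p = (if n = d then p else 0)"
  by (rule poly_mapping_eqI) (auto simp: lookup_hcomp forms_def in_keys_iff)

lemma hcomp_mult_form:
  assumes F: "F \<in> forms a" and t: "a \<le> t"
  shows "hcomp t (p * F) = hcomp (t - a) p * F"
proof (induction p rule: mpol_induct)
  case (single e c)
  have s: "Poly_Mapping.single e c \<in> forms (mdeg e)"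
    by (auto simp: forms_def split: if_splits)
  show ?case
    using t by (auto simp: hcomp_forms[OF forms_mult[OF s F]] hcomp_forms[OF s])
qed (auto simp: hcomp_add distrib_right)

text \<open>
  Division of forms by a form \<open>G\<close> of degree \<open>b\<close> that contains the power \<open>x\<^sub>i\<^sup>b\<close> leaves a remainder of
  degree less than \<open>b\<close> in \<open>x\<^sub>i\<close>.
\<close>

lemma forms_division:
  fixes G :: "('i, 'k::field) mpol"
  assumes G: "G \<in> forms b" and lc: "Poly_Mapping.lookup G (Poly_Mapping.single i b) \<noteq> 0" and p: "p \<in> forms n"
  obtains q r where "p = q * G + r" and "if b \<le> n then q \<in> forms (n - b) else q = 0"
    and "r \<in> forms n" and "\<And>e. e \<in> Poly_Mapping.keys r \<Longrightarrow> Poly_Mapping.lookup e i < b"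
proof -
  define D where "D p \<longleftrightarrow> (\<exists>q r. p = q * G + r \<and> (if b \<le> n then q \<in> forms (n - b) else q = 0) \<and>
    r \<in> forms n \<and> (\<forall>e\<in>Poly_Mapping.keys r. Poly_Mapping.lookup e i < b))" for p
  have D0: "D 0"
    unfolding D_def by (intro exI[of _ 0]) (auto simp: forms_def)
  have D_add: "D (p + p')" if Dp: "D p" and Dp': "D p'" for p p'
  proof -
    obtain q r where 1: "p = q * G + r" "if b \<le> n then q \<in> forms (n - b) else q = 0"
        "r \<in> forms n" "\<forall>e\<in>Poly_Mapping.keys r. Poly_Mapping.lookup e i < b"
      using Dp unfolding D_def by blast
    obtain q' r' where 2: "p' = q' * G + r'" "if b \<le> n then q' \<in> forms (n - b) else q' = 0"
        "r' \<in> forms n" "\<forall>e\<in>Poly_Mapping.keys r'. Poly_Mapping.lookup e i < b"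
      using Dp' unfolding D_def by blast
    show ?thesis
      unfolding D_def
    proof (intro exI conjI)
      show "p + p' = (q + q') * G + (r + r')"
        using 1 2 by (simp add: algebra_simps)
      show "if b \<le> n then q + q' \<in> forms (n - b) else q + q' = 0"
        using 1 2 by (auto intro: forms_add)
      show "\<forall>e\<in>Poly_Mapping.keys (r + r'). Poly_Mapping.lookup e i < b"
        using 1 2 keys_add[of r r'] by blast
    qed (use 1 2 in \<open>auto intro: forms_add\<close>)
  qed
  have D_sum: "D (sum h I)" if "\<And>j. j \<in> I \<Longrightarrow> D (h j)" for h :: "('i \<Rightarrow>\<^sub>0 nat) \<Rightarrow> _" and I
    using that by (induction I rule: infinite_finite_induct) (auto intro: D0 D_add)
  define c where "c = Poly_Mapping.lookup G (Poly_Mapping.single i b)"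
  define G' where "G' = G - Poly_Mapping.single (Poly_Mapping.single i b) c"
  have G': "mdeg e = b \<and> Poly_Mapping.lookup e i < b" if "e \<in> Poly_Mapping.keys G'" for e
  proof -
    have ne: "e \<noteq> Poly_Mapping.single i b" and "e \<in> Poly_Mapping.keys G"
      using that by (auto simp: G'_def c_def in_keys_iff lookup_minus lookup_single when_def split: if_splits)
    then have deg: "mdeg e = b"
      using G by (auto simp: forms_def)
    moreover have "Poly_Mapping.lookup e i \<noteq> b"
      using ne deg lookup_eq_mdeg[of e i] by auto
    ultimately show ?thesis
      using lookup_le_mdeg[of e i] by simp
  qed
  have D_single: "D (Poly_Mapping.single e x)" if "mdeg e = n" for e x
    using that
  proof (induction "Poly_Mapping.lookup e i" arbitrary: e x rule: less_induct)
    case less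
    show ?case
    proof (cases "Poly_Mapping.lookup e i < b")
      case True
      then show ?thesis
        unfolding D_def using less.prems
        by (intro exI[of _ 0] exI[of _ "Poly_Mapping.single e x"]) (auto simp: forms_def split: if_splits)
    next
      case False
      define d where "d = e - Poly_Mapping.single i b"
      have e: "e = d + Poly_Mapping.single i b"
        using False by (intro poly_mapping_eqI) (auto simp: d_def lookup_add lookup_minus lookup_single when_def)
      have bn: "b \<le> n" and degd: "mdeg d = n - b"
        using less.prems unfolding e by (auto simp: mdeg_add)
      have "Poly_Mapping.single e x = Poly_Mapping.single d (x / c) * Poly_Mapping.single (Poly_Mapping.single i b) c"
        using lc by (simp add: mult_single e c_def)
      also have "\<dots> = Poly_Mapping.single d (x / c) * G + (- Poly_Mapping.single d (x / c)) * G'"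
        by (simp add: G'_def algebra_simps)
      also have "- Poly_Mapping.single d (x / c) = Poly_Mapping.single d (- x / c)"
        by (simp add: single_uminus)
      also have "Poly_Mapping.single d (- x / c) * G' = (\<Sum>e'\<in>Poly_Mapping.keys G'.
          Poly_Mapping.single (d + e') (- x / c * Poly_Mapping.lookup G' e'))"
        by (subst mpol_sum_single[of G']) (simp add: sum_distrib_left mult_single)
      finally have eq: "Poly_Mapping.single e x = Poly_Mapping.single d (x / c) * G +
        (\<Sum>e'\<in>Poly_Mapping.keys G'. Poly_Mapping.single (d + e') (- x / c * Poly_Mapping.lookup G' e'))" .
      have "D (Poly_Mapping.single d (x / c) * G)"
        unfolding D_def using bn degd
        by (intro exI[of _ "Poly_Mapping.single d (x / c)"] exI[of _ 0])
          (auto simp: forms_def split: if_splits)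
      moreover have "D (Poly_Mapping.single (d + e') (- x / c * Poly_Mapping.lookup G' e'))"
        if "e' \<in> Poly_Mapping.keys G'" for e'
        using G'[OF that] bn degd by (intro less.hyps) (auto simp: e lookup_add mdeg_add)
      ultimately show ?thesis
        unfolding eq by (intro D_add D_sum)
    qed
  qed
  have "D p"
    by (subst mpol_sum_single, rule D_sum, rule D_single) (use p in \<open>auto simp: forms_def\<close>)
  then show ?thesis
    using that unfolding D_def by blast
qed

lemma mult_mem_span_monomials:
  fixes F :: "('i, 'k::field) mpol"
  assumes "Poly_Mapping.keys p \<subseteq> E"
  shows "p * F \<in> module.span kscale ((\<lambda>e. Poly_Mapping.single e 1 * F) ` E)"
proof -
  interpret V: vector_space "kscale :: 'k \<Rightarrow> ('i, 'k) mpol \<Rightarrow> _" by (rule vector_space_kscale)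
  have "p * F = (\<Sum>e\<in>Poly_Mapping.keys p. kscale (Poly_Mapping.lookup p e) (Poly_Mapping.single e 1 * F))"
    by (subst mpol_sum_single[of p])
      (simp add: sum_distrib_right kscale_def mult_single flip: mult.assoc)
  also have "\<dots> \<in> V.span ((\<lambda>e. Poly_Mapping.single e 1 * F) ` E)"
    using assms by (intro V.span_sum V.span_scale V.span_base) auto
  finally show ?thesis .
qed

text \<open>
  In \<open>p F + q G\<close> the form \<open>p\<close> may be replaced by its remainder modulo \<open>G\<close>. Counting monomials gives
  the bound \<open>dim [R]\<^sub>t\<^sub>-\<^sub>a + dim [R]\<^sub>t\<^sub>-\<^sub>b - dim [R]\<^sub>t\<^sub>-\<^sub>a\<^sub>-\<^sub>b\<close> known from the Koszul complex.
\<close>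

lemma kdim_pair_ideal_le:
  fixes F G :: "'k::field R4"
  assumes F: "F \<in> forms a" and G: "G \<in> forms b"
    and lc: "Poly_Mapping.lookup G (Poly_Mapping.single i b) \<noteq> 0" and t: "a \<le> t" "b \<le> t"
  shows "kdim (gen_ideal {F, G} \<inter> forms t) + ((t - a + 3 - b) choose 3)
    \<le> ((t - a + 3) choose 3) + ((t - b + 3) choose 3)"
proof -
  interpret V: vector_space "kscale :: 'k \<Rightarrow> 'k R4 \<Rightarrow> _" by (rule vector_space_kscale)
  let ?m = "\<lambda>H e. Poly_Mapping.single e (1::'k) * H"
  let ?E1 = "{e. mdeg e = t - a \<and> Poly_Mapping.lookup e i < b}" and ?E2 = "{e :: 4 \<Rightarrow>\<^sub>0 nat. mdeg e = t - b}"
  let ?W = "?m F ` ?E1 \<union> ?m G ` ?E2"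
  have fin: "finite ?E1" "finite ?E2"
    using finite_exponents[of "t - a"] finite_exponents[of "t - b"]
    by (auto elim: rev_finite_subset)
  have "gen_ideal {F, G} \<inter> forms t \<subseteq> V.span ?W"
  proof
    fix f assume f: "f \<in> gen_ideal {F, G} \<inter> forms t"
    then obtain p q where pq: "f = p * F + q * G"
      by (auto simp: gen_ideal_pair)
    have "f = hcomp t f"
      using f hcomp_forms[of f t t] by simp
    then have f1: "f = hcomp (t - a) p * F + hcomp (t - b) q * G"
      using F G t by (simp add: pq hcomp_add hcomp_mult_form)
    obtain s r where sr: "hcomp (t - a) p = s * G + r"
      "if b \<le> t - a then s \<in> forms (t - a - b) else s = 0" "r \<in> forms (t - a)"
      "\<And>e. e \<in> Poly_Mapping.keys r \<Longrightarrow> Poly_Mapping.lookup e i < b"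
      by (rule forms_division[OF G lc hcomp_mem[of "t - a" p]]) blast
    have "s * F \<in> forms (t - b)"
    proof (cases "b \<le> t - a")
      case True
      then have "s * F \<in> forms (t - a - b + a)"
        using sr(2) F by (auto intro: forms_mult)
      then show ?thesis
        using True t by simp
    qed (use sr(2) in \<open>auto simp: forms_def\<close>)
    then have "s * F + hcomp (t - b) q \<in> forms (t - b)"
      by (intro forms_add hcomp_mem)
    then have "Poly_Mapping.keys (s * F + hcomp (t - b) q) \<subseteq> ?E2"
      by (auto simp: forms_def)
    moreover have "Poly_Mapping.keys r \<subseteq> ?E1"
      using sr(3,4) by (auto simp: forms_def)
    moreover have "f = r * F + (s * F + hcomp (t - b) q) * G"
      using f1 by (simp add: sr(1) algebra_simps)
    ultimately show "f \<in> V.span ?W"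
      using mult_mem_span_monomials[of r ?E1 F] mult_mem_span_monomials[of _ ?E2 G]
        V.span_mono[of "?m F ` ?E1" ?W] V.span_mono[of "?m G ` ?E2" ?W]
      by (auto intro!: V.span_add)
  qed
  then have "kdim (gen_ideal {F, G} \<inter> forms t) \<le> card ?W"
    unfolding kdim_def using fin by (intro V.dim_le_card) auto
  also have "\<dots> \<le> card ?E1 + card ?E2"
    using fin card_image_le card_Un_le by (meson add_mono order_trans)
  also have "card ?E2 = (t - b + 3) choose 3"
    by (rule card_exponents)
  finally show ?thesis
    using card_exponents_bounded[of "t - a" i b] by linarith
qed

lemma kdim_pos:
  fixes V :: "'k::field R4 set"
  assumes "V \<subseteq> forms t" and "z \<in> V" and "z \<noteq> 0"
  shows "kdim V > 0"
proof -
  interpret V: vector_space "kscale :: 'k \<Rightarrow> 'k R4 \<Rightarrow> _" by (rule vector_space_kscale)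
  obtain B where B: "B \<subseteq> V" "V.independent B" "V \<subseteq> V.span B" "card B = V.dim V"
    using V.basis_exists .
  let ?T = "(\<lambda>e. Poly_Mapping.single e (1::'k) * 1) ` {e. mdeg e = t}"
  have "B \<subseteq> V.span ?T"
  proof
    fix x assume "x \<in> B"
    then have "Poly_Mapping.keys x \<subseteq> {e. mdeg e = t}"
      using B(1) assms(1) by (auto simp: forms_def)
    from mult_mem_span_monomials[OF this, of 1] show "x \<in> V.span ?T" by simp
  qed
  then have "finite B"
    using V.independent_span_bound[of ?T B] finite_exponents B(2) by blast
  moreover have "B \<noteq> {}"
    using assms(2,3) B(3) V.span_empty by auto
  ultimately show ?thesis
    using B(4) unfolding kdim_def by (metis card_gt_0_iff)
qed

text \<open>
  The bound for the dimension of \<open>[(F, G)]\<^sub>t\<close> does not exceed the number of conditions imposed by a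
  point of multiplicity \<open>t - 1\<close>. In terms of \<open>u = a - 3\<close> and \<open>v = b - 3\<close> the difference is a
  polynomial with nonnegative coefficients.
\<close>

lemma binomial_inequality:
  assumes a: "a = u + 3" and b: "b = v + 3" and t: "t = (a - 1) * (b - 1) + 1"
  shows "((t - a + 3) choose 3) + ((t - b + 3) choose 3) \<le> ((t + 1) choose 3) + ((t - a + 3 - b) choose 3)"
proof -
  have choose2: "2 * ((n + 2) choose 2) = (n + 2) * (n + 1)" for n :: nat
  proof (induction n)
    case (Suc n)
    have "(Suc n + 2) choose 2 = (n + 2) + ((n + 2) choose 2)"
      by (simp add: numeral_2_eq_2)
    with Suc show ?case by simp
  qed (simp add: choose_two)
  have choose3: "6 * ((n + 2) choose 3) = (n + 2) * (n + 1) * n" for n :: nat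
  proof (induction n)
    case (Suc n)
    have "(Suc n + 2) choose 3 = ((n + 2) choose 2) + ((n + 2) choose 3)"
      by (simp add: numeral_3_eq_3 numeral_2_eq_2)
    with Suc choose2[of n] show ?case by (simp add: algebra_simps)
  qed (simp add: binomial_eq_0)
  have t': "t - a + 3 = (3 + u + 2 * v + u * v) + 2" "t - b + 3 = (3 + 2 * u + v + u * v) + 2"
    "t + 1 = (4 + 2 * u + 2 * v + u * v) + 2" "t - a + 3 - b = (u + v + u * v) + 2"
    by (simp_all add: a b t algebra_simps)
  have "6 * (((t - a + 3) choose 3) + ((t - b + 3) choose 3))
    + 3 * (3 * (u + v) + (u + v) * (u + v) + 2 * u * v + u * v * (u + v))
    = 6 * (((t + 1) choose 3) + ((t - a + 3 - b) choose 3))"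
    unfolding distrib_left[of 6] t'(4) unfolding t'(1-3) choose3 by (simp add: algebra_simps)
  then have "6 * (((t - a + 3) choose 3) + ((t - b + 3) choose 3))
    \<le> 6 * (((t + 1) choose 3) + ((t - a + 3 - b) choose 3))"
    by (metis le_add1)
  then show ?thesis
    by (rule nat_mult_le_cancel1[THEN iffD1, rotated]) (rule zero_less_numeral)
qed


section \<open>The general pair of forms\<close>

text \<open>The \<open>i\<close>-th coordinate point.\<close>

definition unit_pt :: "4 \<Rightarrow> 4 \<Rightarrow> 'k::zero_neq_one" where
  "unit_pt i j = (if j = i then 1 else 0)"

text \<open>
  The restriction to a line of the form of degree \<open>n\<close> whose coefficients are the variables \<open>\<iota> e\<close>.
\<close>

definition generic_line ::
  "((4 \<Rightarrow>\<^sub>0 nat) \<Rightarrow> 'j) \<Rightarrow> nat \<Rightarrow> (4 \<Rightarrow> 'k::comm_ring_1) \<Rightarrow> (4 \<Rightarrow> 'k) \<Rightarrow> ('j, 'k) mpol poly" where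
  "generic_line \<iota> n v w = (\<Sum>e | mdeg e = n.
     Polynomial.smult (mvar (\<iota> e)) (map_poly mconst (monom_val (\<lambda>i. [:v i, w i:]) e)))"

lemma specialize_generic_line:
  assumes F: "F \<in> forms n" and \<sigma>: "\<And>e. \<sigma> (\<iota> e) = Poly_Mapping.lookup F e"
  shows "map_poly (mev \<sigma>) (generic_line \<iota> n v w) = line (\<lambda>c. c) v w F"
proof -
  interpret comm_ring_hom "mev \<sigma>" by (rule mev_hom)
  interpret mp: map_poly_comm_ring_hom "mev \<sigma>" ..
  have "map_poly (mev \<sigma>) (map_poly mconst q) = q" for q
    by (rule poly_eqI) (simp add: coeff_map_poly)
  then have "map_poly (mev \<sigma>) (generic_line \<iota> n v w) =
      (\<Sum>e | mdeg e = n. Polynomial.smult (Poly_Mapping.lookup F e) (monom_val (\<lambda>i. [:v i, w i:]) e))"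
    by (simp add: generic_line_def hom_distribs \<sigma>)
  also have "\<dots> = line (\<lambda>c. c) v w F"
    unfolding line_def
    using F by (subst msubst_superset[OF const_poly_hom[OF id_hom] finite_exponents[of n]])
      (auto simp: forms_def)
  finally show ?thesis .
qed

text \<open>
  The conditions on the pair \<open>(F, G)\<close>, in terms of the restrictions to two coordinate lines: \<open>G\<close> has
  full degree \<open>b\<close> and the resultant does not vanish on the line \<open>x\<^sub>0 = x\<^sub>1 = 0\<close>; the leading
  coefficient of the first subresultant does not vanish on the line \<open>x\<^sub>2 = x\<^sub>3 = 0\<close>.
\<close>

definition general_pairs :: "nat \<Rightarrow> nat \<Rightarrow> ('k::field R4 \<times> 'k R4) set" where
  "general_pairs a b = {(F, G). F \<in> forms a \<and> G \<in> forms b \<and>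
     coeff (line (\<lambda>c. c) (unit_pt 2) (unit_pt 3) G) b \<noteq> 0 \<and>
     subres_coeff 0 0 a b (line (\<lambda>c. c) (unit_pt 2) (unit_pt 3) F)
       (line (\<lambda>c. c) (unit_pt 2) (unit_pt 3) G) \<noteq> 0 \<and>
     subres_coeff 1 1 a b (line (\<lambda>c. c) (unit_pt 1) (unit_pt 0) F)
       (line (\<lambda>c. c) (unit_pt 1) (unit_pt 0) G) \<noteq> 0}"

lemma general_pairs_open: "forms_pair_open a b (general_pairs a b :: ('k::field R4 \<times> 'k R4) set)"
proof -
  let ?f = "generic_line Inl a :: (4 \<Rightarrow> 'k) \<Rightarrow> _" and ?g = "generic_line Inr b :: (4 \<Rightarrow> 'k) \<Rightarrow> _"
  define \<Delta> where "\<Delta> = coeff (?g (unit_pt 2) (unit_pt 3)) b *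
    subres_coeff 0 0 a b (?f (unit_pt 2) (unit_pt 3)) (?g (unit_pt 2) (unit_pt 3)) *
    subres_coeff 1 1 a b (?f (unit_pt 1) (unit_pt 0)) (?g (unit_pt 1) (unit_pt 0))"
  have "(F, G) \<in> general_pairs a b \<longleftrightarrow> F \<in> forms a \<and> G \<in> forms b \<and>
      mev (case_sum (Poly_Mapping.lookup F) (Poly_Mapping.lookup G)) \<Delta> \<noteq> 0" for F G :: "'k R4"
  proof (cases "F \<in> forms a \<and> G \<in> forms b")
    case True
    let ?\<sigma> = "case_sum (Poly_Mapping.lookup F) (Poly_Mapping.lookup G)"
    interpret comm_ring_hom "mev ?\<sigma>" by (rule mev_hom)
    have F: "map_poly (mev ?\<sigma>) (?f v w) = line (\<lambda>c. c) v w F" for v w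
      using True by (intro specialize_generic_line) auto
    have G: "map_poly (mev ?\<sigma>) (?g v w) = line (\<lambda>c. c) v w G" for v w
      using True by (intro specialize_generic_line) auto
    have "mev ?\<sigma> (coeff (?g v w) b) = coeff (line (\<lambda>c. c) v w G) b" for v w
      by (simp flip: G add: coeff_map_poly)
    then have "mev ?\<sigma> \<Delta> = coeff (line (\<lambda>c. c) (unit_pt 2) (unit_pt 3) G) b *
       subres_coeff 0 0 a b (line (\<lambda>c. c) (unit_pt 2) (unit_pt 3) F)
         (line (\<lambda>c. c) (unit_pt 2) (unit_pt 3) G) *
       subres_coeff 1 1 a b (line (\<lambda>c. c) (unit_pt 1) (unit_pt 0) F)
         (line (\<lambda>c. c) (unit_pt 1) (unit_pt 0) G)"
      by (simp add: \<Delta>_def hom_mult subres_coeff_hom[OF mev_hom] F G)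
    with True show ?thesis
      by (simp add: general_pairs_def)
  qed (auto simp: general_pairs_def)
  then have "general_pairs a b = {(F, G). F \<in> forms a \<and> G \<in> forms b \<and>
      (\<exists>p\<in>{\<Delta>}. mev (case_sum (Poly_Mapping.lookup F) (Poly_Mapping.lookup G)) p \<noteq> 0)}"
    by auto
  then show ?thesis
    unfolding forms_pair_open_def by blast
qed

lemma general_pairs_nonempty:
  assumes "2 \<le> a" and "1 \<le> b"
  shows "(general_pairs a b :: ('k::field R4 \<times> 'k R4) set) \<noteq> {}"
proof -
  interpret forms: graded "forms :: nat \<Rightarrow> 'k R4 set" by (rule graded_forms)
  define F G :: "'k R4" where "F = mvar 2 ^ a + mvar 0 * mvar 1 ^ (a - 1)" and "G = mvar 3 ^ b + mvar 0 ^ b"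
  have pow: "mvar i ^ n \<in> (forms n :: 'k R4 set)" for i n
    using forms.power_mem[of "mvar i" 1 n] by simp
  have "mvar 0 * mvar 1 ^ (a - 1) \<in> (forms a :: 'k R4 set)"
    using forms.mult_mem[OF pow[of 0 1] pow[of 1 "a - 1"]] assms by simp
  then have forms: "F \<in> forms a" "G \<in> forms b"
    by (auto simp: F_def G_def intro: forms.add_mem pow)
  note hom = line_hom[OF id_hom]
  have line_mvar: "line (\<lambda>c. c) v w (mvar i) = [:v i, w i:]" for v w :: "4 \<Rightarrow> 'k" and i
    by (rule line_mvar[OF id_hom])
  have line_F: "line (\<lambda>c. c) v w F = [:v 2, w 2:] ^ a + [:v 0, w 0:] * [:v 1, w 1:] ^ (a - 1)"
    and line_G: "line (\<lambda>c. c) v w G = [:v 3, w 3:] ^ b + [:v 0, w 0:] ^ b" for v w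
  proof -
    interpret comm_ring_hom "line (\<lambda>c. c) v w" by (rule hom)
    show "line (\<lambda>c. c) v w F = [:v 2, w 2:] ^ a + [:v 0, w 0:] * [:v 1, w 1:] ^ (a - 1)"
      by (simp add: F_def hom_distribs line_mvar)
    show "line (\<lambda>c. c) v w G = [:v 3, w 3:] ^ b + [:v 0, w 0:] ^ b"
      by (simp add: G_def hom_distribs line_mvar)
  qed
  have X: "[:0, 1::'k:] = monom 1 1"
    by (simp add: monom_altdef)
  have one: "[:1::'k:] ^ n = monom 1 0" for n
    by (simp add: monom_eq_1 flip: one_pCons)
  have "line (\<lambda>c. c) (unit_pt 2) (unit_pt 3) F = monom 1 0"
    and "line (\<lambda>c. c) (unit_pt 2) (unit_pt 3) G = monom 1 b"
    and "line (\<lambda>c. c) (unit_pt 1) (unit_pt 0) F = monom 1 1"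
    and "line (\<lambda>c. c) (unit_pt 1) (unit_pt 0) G = monom 1 b"
    using assms by (simp_all add: line_F line_G unit_pt_def X one monom_power zero_power mult_monom)
  then have "(F, G) \<in> general_pairs a b"
    using assms forms subres_coeff_monom[of 0 a b, where ?'s = 'k] subres_coeff_monom[of 1 a b, where ?'s = 'k]
    by (simp add: general_pairs_def)
  then show ?thesis by blast
qed

lemma lookup_nonzero_if_coeff_line:
  fixes G :: "'k::field R4"
  assumes G: "G \<in> forms b" and c: "coeff (line (\<lambda>c. c) (unit_pt i) (unit_pt j) G) b \<noteq> 0"
  shows "Poly_Mapping.lookup G (Poly_Mapping.single j b) \<noteq> 0"
proof -
  let ?v = "\<lambda>l. [:unit_pt i l, unit_pt j l :: 'k:]"
  have "coeff (\<Sum>e\<in>Poly_Mapping.keys G. [:Poly_Mapping.lookup G e:] * monom_val ?v e) b \<noteq> 0"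
    using c by (simp add: line_def msubst_def)
  then obtain e where e: "e \<in> Poly_Mapping.keys G" "coeff (monom_val ?v e) b \<noteq> 0"
    unfolding coeff_sum by (force elim: sum.not_neutral_contains_not_neutral)
  have deg: "mdeg e = b"
    using e(1) G by (auto simp: forms_def)
  have deg_v: "degree (?v l ^ n) \<le> (if l = j then n else 0)" for l n
  proof -
    have "degree (?v l ^ n) \<le> degree (?v l) * n"
      by (rule degree_power_le)
    also have "\<dots> \<le> (if l = j then n else 0)"
      by (simp add: unit_pt_def)
    finally show ?thesis .
  qed
  have "b \<le> degree (monom_val ?v e)"
    by (rule le_degree[OF e(2)])
  also have "\<dots> \<le> (\<Sum>l\<in>Poly_Mapping.keys e. degree (?v l ^ Poly_Mapping.lookup e l))"
    unfolding monom_val_def using degree_prod_sum_le[OF finite_keys] by (simp add: o_def)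
  also have "\<dots> \<le> (\<Sum>l\<in>Poly_Mapping.keys e. if l = j then Poly_Mapping.lookup e j else 0)"
  proof (rule sum_mono)
    fix l
    show "degree (?v l ^ Poly_Mapping.lookup e l) \<le> (if l = j then Poly_Mapping.lookup e j else 0)"
      using deg_v[of l "Poly_Mapping.lookup e l"] by (cases "l = j") simp_all
  qed
  also have "\<dots> \<le> Poly_Mapping.lookup e j"
    by simp
  finally have "e = Poly_Mapping.single j b"
    using lookup_le_mdeg[of e j] lookup_eq_mdeg[of e j] deg by simp
  with e(1) show ?thesis
    by (simp add: in_keys_iff)
qed


section \<open>General pairs define complete intersections and saturated ideals\<close>

lemma mvar_dvd_if_subst_zero:
  fixes x :: "('i, 'k::comm_ring_1) mpol"
  assumes "msubst mconst (\<lambda>j. if j = i then 0 else mvar j) x = 0"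
  shows "mvar i dvd x"
proof -
  let ?v = "\<lambda>j. if j = i then 0 else mvar j :: ('i, 'k) mpol"
  have "mvar i dvd p - msubst mconst ?v p" for p :: "('i, 'k) mpol"
  proof (induction p rule: mpol_induct)
    case zero
    show ?case by (simp add: msubst_def)
  next
    case (single e c)
    show ?case
    proof (cases "i \<in> Poly_Mapping.keys e")
      case True
      define d where "d = e - Poly_Mapping.single i 1"
      have e: "e = Poly_Mapping.single i 1 + d"
        using True
        by (intro poly_mapping_eqI)
          (auto simp: d_def lookup_add lookup_minus lookup_single when_def in_keys_iff)
      have "Poly_Mapping.single e c = mvar i * Poly_Mapping.single d c"
        by (simp add: e mvar_def mult_single)
      moreover have "monom_val ?v e = 0"
        by (simp add: e monom_val_add)
      then have "msubst mconst ?v (Poly_Mapping.single e c) = 0"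
        by (simp add: msubst_single[OF mconst_hom])
      ultimately show ?thesis
        by (metis diff_zero dvd_triv_left)
    next
      case False
      then have "monom_val ?v e = monom_val mvar e"
        unfolding monom_val_def by (intro prod.cong) auto
      then show ?thesis
        by (simp add: msubst_single[OF mconst_hom] monom_val_mvar mult_single)
    qed
  next
    case (add p q)
    have "p + q - msubst mconst ?v (p + q) = (p - msubst mconst ?v p) + (q - msubst mconst ?v q)"
      by (simp add: msubst_add[OF mconst_hom])
    with add show ?case
      by (simp only: dvd_add)
  qed
  from this[of x] show ?thesis
    using assms by simp
qed

text \<open>
  In the direction \<open>x\<^sub>3\<close> the restriction \<open>\<theta>\<close> to a line is the identification of \<open>R\<close> with
  \<open>K[x\<^sub>0, x\<^sub>1, x\<^sub>2][X]\<close>, and evaluation at \<open>X = x\<^sub>3\<close> is its inverse. The resultant \<open>\<rho>\<close> of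
  \<open>F\<close> and \<open>G\<close> with respect to \<open>x\<^sub>3\<close> is nonzero at \<open>x\<^sub>0 = x\<^sub>1 = 0\<close>, hence nonzero modulo \<open>x\<^sub>0\<close>.
\<close>

locale general_pair =
  fixes a b :: nat and F G :: "'k::field R4"
  assumes ab: "2 \<le> a" "2 \<le> b" and general: "(F, G) \<in> general_pairs a b"
begin

lemma F_form: "F \<in> forms a" and G_form: "G \<in> forms b"
  using general by (auto simp: general_pairs_def)

definition \<theta> :: "'k R4 \<Rightarrow> 'k R4 poly" where
  "\<theta> = line mconst (\<lambda>i. if i = 3 then 0 else mvar i) (unit_pt 3)"

lemma theta_hom: "comm_ring_hom \<theta>"
  unfolding \<theta>_def by (rule line_hom[OF mconst_hom])

sublocale theta: comm_ring_hom \<theta> by (rule theta_hom)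

lemma poly_theta: "poly (\<theta> p) (mvar 3) = p"
proof -
  have "(\<lambda>i. (if i = 3 then 0 else mvar i) + mvar 3 * unit_pt 3 i) = (mvar :: 4 \<Rightarrow> 'k R4)"
    by (auto simp: unit_pt_def)
  then show ?thesis
    by (simp add: \<theta>_def poly_line msubst_mvar_id)
qed

lemma map_poly_theta: "map_poly (mev (unit_pt 2)) (\<theta> p) = line (\<lambda>c. c) (unit_pt 2) (unit_pt 3) p"
proof -
  interpret ev: comm_ring_hom "mev (unit_pt 2 :: 4 \<Rightarrow> 'k)" by (rule mev_hom)
  have "(\<lambda>i. mev (unit_pt 2) (if i = 3 then 0 else mvar i)) = (unit_pt 2 :: 4 \<Rightarrow> 'k)"
    by (auto simp: unit_pt_def)
  moreover have "(\<lambda>i. mev (unit_pt 2) (unit_pt 3 i)) = (unit_pt 3 :: 4 \<Rightarrow> 'k)"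
    by (auto simp: unit_pt_def)
  ultimately show ?thesis
    by (simp add: \<theta>_def map_poly_line[OF mev_hom])
qed

lemma theta_graded: "p \<in> forms n \<Longrightarrow> \<theta> p \<in> graded_poly forms n"
proof -
  interpret forms: graded "forms :: nat \<Rightarrow> 'k R4 set" by (rule graded_forms)
  show "p \<in> forms n \<Longrightarrow> \<theta> p \<in> graded_poly forms n"
    unfolding \<theta>_def by (rule forms.line_mem) (auto simp: unit_pt_def)
qed

definition \<rho> :: "'k R4" where
  "\<rho> = subres_coeff 0 0 a b (\<theta> F) (\<theta> G)"

lemma mev_rho: "mev (unit_pt 2) \<rho> \<noteq> 0"
  using general
  by (simp add: \<rho>_def subres_coeff_hom[OF mev_hom] map_poly_theta general_pairs_def)

lemma resultant_bezout: obtains u v where "u * \<theta> F + v * \<theta> G = [:\<rho>:]"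
proof -
  have "degree (\<theta> F) \<le> a" "degree (\<theta> G) \<le> b"
    using theta_graded[OF F_form] theta_graded[OF G_form] by (auto intro: degree_graded_poly)
  from subres_bezout[OF this, of 0] ab that show ?thesis
    by (auto simp: \<rho>_def monom_0)
qed

lemma lead_coeff_theta_G: "degree (\<theta> G) = b" "lead_coeff (\<theta> G) dvd 1"
proof -
  define c where "c = coeff (line (\<lambda>c. c) (unit_pt 2) (unit_pt 3) G) b"
  interpret ev: comm_ring_hom "mev (unit_pt 2 :: 4 \<Rightarrow> 'k)" by (rule mev_hom)
  have c: "c \<noteq> 0"
    using general by (simp add: c_def general_pairs_def)
  have "mev (unit_pt 2) (coeff (\<theta> G) b) = c"
    by (simp add: c_def coeff_map_poly flip: map_poly_theta)
  then have nz: "coeff (\<theta> G) b \<noteq> 0"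
    using c by auto
  then have "coeff (\<theta> G) b \<in> forms 0"
    using theta_graded[OF G_form] by (force simp: graded_poly_def)
  then have "coeff (\<theta> G) b = mconst c"
    using forms_0_const \<open>mev (unit_pt 2) (coeff (\<theta> G) b) = c\<close> by metis
  moreover have "mconst c * mconst (1 / c) = (1 :: 'k R4)"
    using c by (simp add: mult_single)
  ultimately have "coeff (\<theta> G) b dvd 1"
    by (metis dvdI)
  moreover show "degree (\<theta> G) = b"
    using nz degree_graded_poly[OF theta_graded[OF G_form]] le_degree by (metis le_antisym)
  ultimately show "lead_coeff (\<theta> G) dvd 1"
    by simp
qed

lemma F_nonzero: "F \<noteq> 0"
proof
  assume "F = 0"
  then obtain v where v: "v * \<theta> G = [:\<rho>:]"
    using resultant_bezout by (metis add_0 mult_zero_right theta.hom_zero)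
  have rho: "\<rho> \<noteq> 0"
    using mev_rho by (auto simp: mev_def)
  then have "v \<noteq> 0" "\<theta> G \<noteq> 0"
    using v by auto
  then have "degree v + b = degree [:\<rho>:]"
    using lead_coeff_theta_G(1) by (metis degree_mult_eq v)
  then show False
    using ab by simp
qed

lemma regular_F_G:
  assumes "G * h \<in> gen_ideal {F}"
  shows "h \<in> gen_ideal {F}"
proof -
  obtain p where p: "G * h = p * F"
    using assms by (auto simp: gen_ideal_single)
  obtain u v where bez: "u * \<theta> F + v * \<theta> G = [:\<rho>:]"
    using resultant_bezout .
  have "\<theta> G * \<theta> h = \<theta> p * \<theta> F"
    using p by (metis theta.hom_mult)
  moreover have "\<rho> \<noteq> 0"
    using mev_rho by (auto simp: mev_def)
  ultimately obtain q where "\<theta> h = q * \<theta> F"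
    using regular_pair[OF lead_coeff_theta_G(2) bez] by blast
  then have "poly (\<theta> h) (mvar 3) = poly q (mvar 3) * poly (\<theta> F) (mvar 3)"
    by simp
  then show ?thesis
    unfolding poly_theta gen_ideal_single by blast
qed

lemma regular_F_G_x0:
  assumes "mvar 0 * h \<in> gen_ideal {F, G}"
  shows "h \<in> gen_ideal {F, G}"
proof -
  obtain p q where pq: "mvar 0 * h = p * F + q * G"
    using assms by (auto simp: gen_ideal_pair)
  obtain u v where bez: "u * \<theta> F + v * \<theta> G = [:\<rho>:]"
    using resultant_bezout .
  let ?w = "\<lambda>i::4. if i = 0 then 0 else mvar i :: 'k R4"
  let ?\<phi> = "msubst mconst ?w"
  interpret ev: comm_ring_hom "mev (unit_pt 2 :: 4 \<Rightarrow> 'k)" by (rule mev_hom)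
  interpret phi: comm_ring_hom ?\<phi> by (rule msubst_hom[OF mconst_hom])
  have "(\<lambda>i. mev (unit_pt 2) (?w i)) = unit_pt 2"
    by (auto simp: unit_pt_def)
  then have "mev (unit_pt 2) (?\<phi> \<rho>) = mev (unit_pt 2) \<rho>"
    by (simp add: msubst_compose[OF mev_hom] mev_eq_msubst[symmetric])
  then have rho: "?\<phi> \<rho> \<noteq> 0"
    using mev_rho by auto
  have x0: "?\<phi> (mvar 0) = 0"
    by (simp add: msubst_mvar[OF mconst_hom])
  have "mev (\<lambda>_. 1) (mvar 0 :: 'k R4) \<noteq> mev (\<lambda>_. 1) (0 :: 'k R4)"
    unfolding mev_mvar by (simp add: mev_def)
  then have x0': "mvar 0 \<noteq> (0 :: 'k R4)"
    by metis
  have "\<theta> (mvar 0) = [:mvar 0:]"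
    by (simp add: \<theta>_def line_mvar[OF mconst_hom] unit_pt_def)
  then have "[:mvar 0:] * \<theta> h = \<theta> p * \<theta> F + \<theta> q * \<theta> G"
    using arg_cong[OF pq, of \<theta>] by (simp only: theta.hom_add theta.hom_mult)
  then obtain p' q' where "\<theta> h = p' * \<theta> F + q' * \<theta> G"
    using regular_triple[OF phi.comm_ring_hom_axioms mvar_dvd_if_subst_zero x0 x0'
        lead_coeff_theta_G(2) bez rho] by blast
  then have "poly (\<theta> h) (mvar 3) =
      poly p' (mvar 3) * poly (\<theta> F) (mvar 3) + poly q' (mvar 3) * poly (\<theta> G) (mvar 3)"
    by simp
  then show ?thesis
    unfolding poly_theta gen_ideal_pair by blast
qed

lemma defines_ci2: "defines_ci2 F G"
proof -
  have zero: "mev (\<lambda>_. 0) p = 0" if "p \<in> forms n" "n > 0" for p :: "'k R4" and n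
    using msubst_scale[OF that(1), of "\<lambda>c. c" 0 "\<lambda>_. 0"] that(2)
    by (simp add: mev_eq_msubst zero_power)
  interpret ev: comm_ring_hom "mev (\<lambda>_. 0 :: 'k)" by (rule mev_hom)
  have "mev (\<lambda>_. 0) p = 0" if "p \<in> gen_ideal {F, G}" for p
    using that zero[OF F_form] zero[OF G_form] ab by (auto simp: gen_ideal_pair ev.hom_add ev.hom_mult)
  then have "1 \<notin> gen_ideal {F, G}"
    by (metis ev.hom_one zero_neq_one)
  then show ?thesis
    unfolding defines_ci2_def regular_seq_def
    using regular_F_G F_nonzero
    by (auto simp: less_Suc_eq gen_ideal_empty numeral_2_eq_2)
qed

lemma scheme_idl2_eq: "scheme_idl2 F G = gen_ideal {F, G}"
proof (intro equalityI subsetI)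
  fix f assume "f \<in> scheme_idl2 F G"
  then obtain n where n: "\<forall>g\<in>idl_power (gen_ideal (range mvar)) n. g * f \<in> gen_ideal {F, G}"
    by (auto simp: scheme_idl2_def sat_idl_def)
  have "mvar 0 ^ n \<in> idl_power (gen_ideal (range mvar :: 'k R4 set)) n"
    by (intro power_mem_idl_power gen_ideal_superset) simp
  with n have "mvar 0 ^ n * f \<in> gen_ideal {F, G}"
    by blast
  then show "f \<in> gen_ideal {F, G}"
  proof (induction n)
    case (Suc n)
    then have "mvar 0 * (mvar 0 ^ n * f) \<in> gen_ideal {F, G}"
      by (simp add: mult.assoc)
    then show ?case
      using Suc.IH regular_F_G_x0 by blast
  qed simp
next
  fix f assume "f \<in> gen_ideal {F, G}"
  then have "\<forall>g\<in>idl_power (gen_ideal (range mvar)) 0. g * f \<in> gen_ideal {F, G}"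
    by (simp add: gen_ideal_mult)
  then show "f \<in> scheme_idl2 F G"
    unfolding scheme_idl2_def sat_idl_def by blast
qed

end


section \<open>The surface given by the first subresultant\<close>

text \<open>
  The polynomials in \<open>X\<close> all of whose coefficients lie in \<open>A n\<close>: here \<open>X\<close> has degree \<open>0\<close>.
\<close>

lemma (in graded) graded_coeffs: "graded (\<lambda>n. {q. \<forall>j. coeff q j \<in> A n})"
proof
  fix i j and p q :: "'s poly"
  assume "p \<in> {q. \<forall>k. coeff q k \<in> A i}" and "q \<in> {q. \<forall>k. coeff q k \<in> A j}"
  then show "p * q \<in> {q. \<forall>k. coeff q k \<in> A (i + j)}"
    by (auto simp: coeff_mult intro!: sum_mem mult_mem)
qed (auto simp: coeff_1 intro: add_mem uminus_mem)

lemma (in graded) subres_coeff_mem_const: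
  assumes f: "\<And>j. coeff f j \<in> A d" and g: "\<And>j. coeff g j \<in> A d'"
  shows "\<exists>n. subres_coeff k l a b f g \<in> A n"
proof -
  interpret C: graded "\<lambda>n. {q. \<forall>j. coeff q j \<in> A n}" by (rule graded_coeffs)
  have mon: "monom 1 i \<in> {q. \<forall>j. coeff q j \<in> A 0}" for i
    by auto
  let ?w = "\<lambda>i. if i < b - k then d else d'" and ?N = "a + b - 2 * k"
  have row: "coeff (subres_row k b f g i) j \<in> A (?w i)" for i j
    using C.mult_mem[OF mon[of i], of f d] C.mult_mem[OF mon[of "i - (b - k)"], of g d'] f g
    by (auto simp: subres_row_def)
  have "subres_coeff k l a b f g \<in> A ((\<Sum>i<?N. ?w i) - (\<Sum>c<?N. 0))"
    unfolding subres_coeff_def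
  proof (rule det_mem)
    fix i j assume "i < ?N" "j < ?N"
    then show "0 \<le> ?w i \<and> subres_mat k l a b f g $$ (i, j) \<in> A (?w i - 0)"
      using row[of i] by (simp add: subres_mat_def)
  qed simp
  then show ?thesis by blast
qed

text \<open>
  The value at \<open>P\<close> of this polynomial is the leading coefficient of the first subresultant of
  \<open>F\<close> and \<open>G\<close> on the line through \<open>P\<close> and \<open>(0 : 1 : 0 : 0)\<close>.
\<close>

definition general_point_eq :: "nat \<Rightarrow> nat \<Rightarrow> 'k::field R4 \<Rightarrow> 'k R4 \<Rightarrow> 'k R4" where
  "general_point_eq a b F G =
     subres_coeff 1 1 a b (line mconst (\<lambda>i. if i = 1 then mvar 0 else 0) mvar F)
       (line mconst (\<lambda>i. if i = 1 then mvar 0 else 0) mvar G)"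

lemma general_point_eq_form:
  assumes F: "F \<in> forms a" and G: "G \<in> forms b"
  shows "\<exists>n. general_point_eq a b F G \<in> forms n"
proof -
  interpret forms: graded "forms :: nat \<Rightarrow> 'a R4 set" by (rule graded_forms)
  interpret C: graded "\<lambda>n. {q :: 'a R4 poly. \<forall>j. coeff q j \<in> forms n}" by (rule forms.graded_coeffs)
  have "line mconst (\<lambda>i. if i = 1 then mvar 0 else 0) mvar H \<in> {q. \<forall>j. coeff q j \<in> forms n}"
    if "H \<in> forms n" for H :: "'a R4" and n
    unfolding line_def using that
    by (intro C.msubst_mem) (auto simp: coeff_pCons split: nat.splits)
  with F G show ?thesis
    unfolding general_point_eq_def by (intro forms.subres_coeff_mem_const) auto
qed

lemma mev_general_point_eq:
  "mev P (general_point_eq a b F G) =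
    subres_coeff 1 1 a b (line (\<lambda>c. c) (\<lambda>i. P 0 * unit_pt 1 i) P F)
      (line (\<lambda>c. c) (\<lambda>i. P 0 * unit_pt 1 i) P G)"
proof -
  interpret comm_ring_hom "mev P" by (rule mev_hom)
  have "(\<lambda>i. mev P (if i = 1 then mvar 0 else 0)) = (\<lambda>i. P 0 * unit_pt 1 i)"
    by (auto simp: unit_pt_def)
  then show ?thesis
    by (simp add: general_point_eq_def subres_coeff_hom[OF mev_hom] map_poly_line[OF mev_hom])
qed

text \<open>
  Write \<open>p\<^sub>0 x = y + x\<^sub>0 P\<close>, where the linear forms \<open>y\<^sub>i = p\<^sub>0 x\<^sub>i - p\<^sub>i x\<^sub>0\<close> vanish at \<open>P\<close>. The first
  subresultant \<open>s\<^sub>0 + s\<^sub>1 X\<close> of \<open>F(y + X P)\<close> and \<open>G(y + X P)\<close> has coefficients that are homogeneous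
  polynomials in \<open>y\<close>, hence are in powers of the ideal of \<open>P\<close>; its value at \<open>X = x\<^sub>0\<close> is the
  required form.
\<close>

lemma subresultant_surface:
  fixes F G :: "'k::field R4"
  assumes F: "F \<in> forms a" and G: "G \<in> forms b" and ab: "2 \<le> a" "2 \<le> b"
    and P0: "P 0 \<noteq> 0" and gen: "mev P (general_point_eq a b F G) \<noteq> 0"
  defines "m \<equiv> (a - 1) * (b - 1)"
  shows "\<exists>z. z \<noteq> 0 \<and> z \<in> gen_ideal {F, G} \<and> z \<in> idl_power (point_idl P) m \<and> z \<in> forms (m + 1)"
proof -
  let ?A = "\<lambda>n. (forms n :: 'k R4 set) \<inter> idl_power (point_idl P) n"
  interpret forms: graded "forms :: nat \<Rightarrow> 'k R4 set" by (rule graded_forms)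
  interpret A: graded ?A by (rule graded_forms_idl_power)
  define y where "y i = mconst (P 0) * mvar i - mconst (P i) * mvar 0" for i
  have mev_y: "mev Q (y i) = P 0 * Q i - P i * Q 0" for Q i
  proof -
    interpret comm_ring_hom "mev Q" by (rule mev_hom)
    show ?thesis
      by (simp add: y_def hom_minus hom_mult)
  qed
  have y: "y i \<in> ?A 1" for i
  proof -
    have "c \<in> forms 0 \<Longrightarrow> c * mvar j \<in> forms 1" for c :: "'k R4" and j
      using forms.mult_mem[of c 0 "mvar j" 1] by simp
    then have form: "y i \<in> forms 1"
      unfolding y_def diff_conv_add_uminus
      by (intro forms.add_mem forms.uminus_mem) simp_all
    moreover have "mev P (y i) = 0"
      by (simp add: mev_y)
    ultimately have "y i \<in> point_idl P"
      unfolding point_idl_def by (intro gen_ideal_superset) blast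
    with form show ?thesis
      using mem_idl_power_1 by blast
  qed
  define f where "f = line mconst y (\<lambda>i. mconst (P i)) F"
  define g where "g = line mconst y (\<lambda>i. mconst (P i)) G"
  have fA: "f \<in> graded_poly ?A a" and gA: "g \<in> graded_poly ?A b"
    unfolding f_def g_def using y F G by (auto intro!: A.line_mem)
  define s where "s l = subres_coeff 1 l a b f g" for l
  have s: "s 0 \<in> ?A (m + 1)" "s 1 \<in> ?A m"
    using A.subres_coeff_mem[OF fA gA, of 1 0] A.subres_coeff_mem[OF fA gA, of 1 1] ab
    by (simp_all add: s_def m_def)
  obtain u v where "u * f + v * g = (\<Sum>l\<le>1. monom (subres_coeff 1 l a b f g) l)"
    by (rule subres_bezout[OF degree_graded_poly[OF fA] degree_graded_poly[OF gA], of 1])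
      (use ab in auto)
  then have uv: "u * f + v * g = monom (s 0) 0 + monom (s 1) 1"
    by (simp add: s_def)
  define z where "z = s 0 + s 1 * mvar 0"
  have at_x0: "poly (line mconst y (\<lambda>i. mconst (P i)) H) (mvar 0) = mconst (P 0) ^ n * H"
    if "H \<in> forms n" for H :: "'k R4" and n
  proof -
    have "(\<lambda>i. y i + mvar 0 * mconst (P i)) = (\<lambda>i. mconst (P 0) * mvar i)"
      by (simp add: y_def mult.commute)
    then show ?thesis
      by (simp add: poly_line msubst_scale[OF that] msubst_mvar_id)
  qed
  have "poly (u * f + v * g) (mvar 0) = z"
    unfolding uv by (simp add: z_def poly_monom)
  then have "z = (poly u (mvar 0) * mconst (P 0) ^ a) * F + (poly v (mvar 0) * mconst (P 0) ^ b) * G"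
    using at_x0[OF F] at_x0[OF G] by (simp add: f_def g_def mult.assoc)
  then have "z \<in> gen_ideal {F, G}"
    unfolding gen_ideal_pair by blast
  moreover have "z \<in> idl_power (point_idl P) m"
  proof -
    have "s 0 \<in> idl_power (point_idl P) m"
      using s(1) idl_power_Suc_subset[of "s 0" "point_idl P" m] by simp
    moreover have "mvar 0 * s 1 \<in> idl_power (point_idl P) m"
      using s(2) by (intro idl_power_ideal) simp
    ultimately show ?thesis
      unfolding z_def mult.commute[of "s 1"] by (rule idl_power_add)
  qed
  moreover have "z \<in> forms (m + 1)"
    using s forms.mult_mem[of "s 1" m "mvar 0" 1] unfolding z_def by (intro forms.add_mem) auto
  moreover have "z \<noteq> 0"
  proof
    assume z: "z = 0"
    define c where "c l = subres_coeff 1 l a b (line (\<lambda>c. c) (\<lambda>i. P 0 * unit_pt 1 i) P F)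
      (line (\<lambda>c. c) (\<lambda>i. P 0 * unit_pt 1 i) P G)" for l
    \<comment> \<open>The \<open>s\<^sub>l\<close> are constant on lines through \<open>P\<close>, on which \<open>x\<^sub>0\<close> is not constant.\<close>
    have eval: "mev Q (s l) = c l" if "\<And>i. P 0 * Q i - P i * Q 0 = P 0 * unit_pt 1 i" for Q l
      using that
      by (simp add: s_def c_def f_def g_def subres_coeff_hom[OF mev_hom] map_poly_line[OF mev_hom] mev_y)
    have vanish: "c 0 + c 1 * Q 0 = 0" if "\<And>i. P 0 * Q i - P i * Q 0 = P 0 * unit_pt 1 i" for Q
    proof -
      interpret comm_ring_hom "mev Q" by (rule mev_hom)
      have "mev Q z = c 0 + c 1 * Q 0"
        using eval[OF that] by (simp add: z_def hom_add hom_mult)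
      then show ?thesis
        by (simp add: z)
    qed
    have "c 0 + c 1 * 0 = 0"
      using vanish[of "unit_pt 1"] by (simp add: unit_pt_def)
    moreover have "c 0 + c 1 * P 0 = 0"
      using vanish[of "\<lambda>i. unit_pt 1 i + P i"] by (simp add: unit_pt_def algebra_simps)
    ultimately have "c 1 = 0"
      using P0 by simp
    then show False
      using gen by (simp add: mev_general_point_eq c_def)
  qed
  ultimately show ?thesis by blast
qed


section \<open>The unexpected surface\<close>

lemma edim_eq_0:
  fixes F G :: "'k::field R4"
  assumes F: "F \<in> forms a" and G: "G \<in> forms b"
    and lc: "Poly_Mapping.lookup G (Poly_Mapping.single i b) \<noteq> 0" and ab: "3 \<le> a" "3 \<le> b"
  shows "edim (gen_ideal {F, G}) ((a - 1) * (b - 1) + 1) ((a - 1) * (b - 1)) = 0"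
proof -
  obtain u v where uv: "a = u + 3" "b = v + 3"
    using ab by (metis add.commute le_Suc_ex)
  define t where "t = (a - 1) * (b - 1) + 1"
  have "a \<le> t" "b \<le> t"
    by (simp_all add: t_def uv)
  from kdim_pair_ideal_le[OF F G lc this] binomial_inequality[OF uv t_def]
  have "kdim (gen_ideal {F, G} \<inter> forms t) \<le> (t + 1) choose 3"
    by linarith
  moreover have "(a - 1) * (b - 1) + 2 = t + 1"
    by (simp add: t_def)
  ultimately show ?thesis
    unfolding edim_def vdim_def t_def[symmetric] by simp
qed

lemma (in general_pair) admits_unexpected:
  assumes "3 \<le> a" and "3 \<le> b"
  shows "admits_unexpected (scheme_idl2 F G) ((a - 1) * (b - 1) + 1) ((a - 1) * (b - 1))"
proof -
  let ?m = "(a - 1) * (b - 1)"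
  let ?q = "mvar 0 * general_point_eq a b F G"
  define V where "V = {P. P \<noteq> (\<lambda>_. 0) \<and> (\<exists>p\<in>{?q}. mev P p \<noteq> 0)}"
  have mev_q: "mev P ?q = P 0 * mev P (general_point_eq a b F G)" for P :: "4 \<Rightarrow> 'k"
  proof -
    interpret comm_ring_hom "mev P" by (rule mev_hom)
    show ?thesis by (simp add: hom_mult)
  qed
  obtain n where "general_point_eq a b F G \<in> forms n"
    using general_point_eq_form[OF F_form G_form] by blast
  then have "?q \<in> forms (Suc 0 + n)"
    by (intro forms_mult) simp_all
  then have "proj_open V"
    unfolding proj_open_def V_def by (intro exI[of _ "{?q}"]) blast
  moreover have "unit_pt 0 \<in> V"
  proof -
    have "unit_pt 0 \<noteq> (\<lambda>_::4. 0 :: 'k)"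
      by (metis unit_pt_def zero_neq_one)
    moreover have "unit_pt 0 0 = (1 :: 'k)"
      by (simp add: unit_pt_def)
    then have "mev (unit_pt 0) ?q \<noteq> 0"
      using general unfolding mev_q mev_general_point_eq by (simp add: general_pairs_def)
    ultimately show ?thesis
      by (simp add: V_def)
  qed
  moreover have "int (adim (scheme_idl2 F G) (?m + 1) ?m P) > edim (scheme_idl2 F G) (?m + 1) ?m"
    if "P \<in> V" for P
  proof -
    have "P 0 \<noteq> 0" "mev P (general_point_eq a b F G) \<noteq> 0"
      using that by (auto simp: V_def mev_q)
    from subresultant_surface[OF F_form G_form ab this]
    obtain z where "z \<noteq> 0" "z \<in> gen_ideal {F, G} \<inter> idl_power (point_idl P) ?m \<inter> forms (?m + 1)"
      by blast
    then have "adim (scheme_idl2 F G) (?m + 1) ?m P > 0"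
      unfolding adim_def scheme_idl2_eq by (intro kdim_pos) auto
    moreover have "Poly_Mapping.lookup G (Poly_Mapping.single 3 b) \<noteq> 0"
      using general by (intro lookup_nonzero_if_coeff_line[OF G_form]) (auto simp: general_pairs_def)
    then have "edim (scheme_idl2 F G) (?m + 1) ?m = 0"
      unfolding scheme_idl2_eq using assms by (intro edim_eq_0 F_form G_form)
    ultimately show ?thesis by simp
  qed
  ultimately show ?thesis
    unfolding admits_unexpected_def for_general_point_def by blast
qed

theorem proposition5p4:
  fixes a b :: nat
  assumes "a \<le> b" and "a > 2"
  shows "\<exists>U :: ('k::alg_closed_field R4 \<times> 'k R4) set.
    forms_pair_open a b U \<and> U \<noteq> {} \<and>
    (\<forall>(F, G)\<in>U. defines_ci2 F G \<and>
       admits_unexpected (scheme_idl2 F G) ((a - 1) * (b - 1) + 1) ((a - 1) * (b - 1)))"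
proof (intro exI conjI)
  show "forms_pair_open a b (general_pairs a b :: ('k R4 \<times> 'k R4) set)"
    by (rule general_pairs_open)
  show "(general_pairs a b :: ('k R4 \<times> 'k R4) set) \<noteq> {}"
    using assms by (intro general_pairs_nonempty) auto
  show "\<forall>(F, G)\<in>(general_pairs a b :: ('k R4 \<times> 'k R4) set). defines_ci2 F G \<and>
      admits_unexpected (scheme_idl2 F G) ((a - 1) * (b - 1) + 1) ((a - 1) * (b - 1))"
  proof clarify
    fix F G :: "'k R4"
    assume "(F, G) \<in> general_pairs a b"
    then interpret general_pair a b F G
      using assms by unfold_locales auto
    show "defines_ci2 F G \<and>
        admits_unexpected (scheme_idl2 F G) ((a - 1) * (b - 1) + 1) ((a - 1) * (b - 1))"
      using assms by (intro conjI defines_ci2 admits_unexpected) auto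
  qed
qed

end
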